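(* Let $F$ be a natural exponential family on $\mathbb{R}$ and let $\mu$ be an element of $F$ with mean $m_o$. Then there exists a family of $\mu$-$2$-orthogonal polynomials with an exponential generating function if and only if $F$ is cubic.
   Context: $\mathbb{N}=\{0,1,2,\dots\}$ and $\mathbb{N}^*=\{1,2,\dots\}$. For a positive Radon measure $\nu$ on $\mathbb{R}$, let $L_\nu(\theta)=\int_{\mathbb{R}}\exp(\theta x)\,\nu(dx)\le+\infty$, and let $\Theta(\nu)$ be the interior of $\{\theta\in\mathbb{R}: L_\nu(\theta)<\infty\}$. $\mathcal{M}(\mathbb{R})$ is the set of such $\nu$ with $\Theta(\nu)\neq\emptyset$ and $\nu$ not concentrated on one point. For $\nu\in\mathcal{M}(\mathbb{R})$ put $k_\nu=\log L_\nu$ on $\Theta(\nu)$; it is strictly convex and real analytic. For $\theta\in\Theta(\nu)$ let $P(\theta,\nu)(dx)=\exp(\theta x-k_\nu(\theta))\,\nu(dx)$. The natural exponential family (NEF) generated by $\nu$ is $F=F(\nu)=\{P(\theta,\nu):\theta\in\Theta(\nu)\}$. Its domain of the means is the open interval $M_F=k_\nu'(\Theta(\nu))$, and $\psi_\nu:M_F\to\Theta(\nu)$ is the inverse of $k_\nu'$. For $m\in M_F$, $P(m,F)=P(\psi_\nu(m),\nu)$ is the element of $F$ with mean $m$. The variance function of $F$ is $V_F(m)=\int_{\mathbb{R}}(x-m)^2P(m,F)(dx)$, $m\in M_F$. $F$ is called cubic if $V_F$ is (the restriction to $M_F$ of) a polynomial of degree less than or equal to $3$. Let $\mu$ be a measure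 on $\mathbb{R}$ with $\int|x|^n\mu(dx)<\infty$ for all $n\in\mathbb{N}$. A family $(Q_n)_{n\in\mathbb{N}}$ of polynomials on $\mathbb{R}$ is $\mu$-$2$-orthogonal if for all $n,q\in\mathbb{N}^*$ one has $\int Q_n(x)Q_q(x)\,\mu(dx)=0$ whenever $n\ge2q$, and $\int Q_n(x)\,\mu(dx)=0$. The generating function of a sequence of real polynomials $(Q_n)_{n\in\mathbb{N}}$ is exponential if there exist $r>0$ and two real analytic functions $a$ and $b$ defined on $]-r,r[$ such that, for all $z\in\,]-r,r[$ and all $x\in\mathbb{R}$, $\sum_{n\in\mathbb{N}}Q_n(x)\frac{z^n}{n!}=\exp\{a(z)x+b(z)\}$.
   Formalization: The family of polynomials is required to satisfy deg Q_n = n for every n; without this convention Q_0 = 1, Q_n = 0 (n ≥ 1) is 2-orthogonal with an exponential generating function for every element of every family, cubic or not. *)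

theory Defs
  imports "HOL-Analysis.Analysis" "HOL-Computational_Algebra.Polynomial"
begin

(* On the real line every locally finite Borel measure is regular, so local finiteness
   is all that has to be required of a positive Radon measure. *)
definition radon_measure :: "real measure \<Rightarrow> bool" where
  "radon_measure \<nu> \<longleftrightarrow>
     sets \<nu> = sets borel \<and> (\<forall>K. compact K \<longrightarrow> emeasure \<nu> K < \<infinity>)"

definition laplace :: "real measure \<Rightarrow> real \<Rightarrow> ennreal" where
  "laplace \<nu> \<theta> = (\<integral>\<^sup>+ x. ennreal (exp (\<theta> * x)) \<partial>\<nu>)"

definition Theta :: "real measure \<Rightarrow> real set" where
  "Theta \<nu> = interior {\<theta>. laplace \<nu> \<theta> < \<infinity>}"

(* The zero measure is excluded as well: for it every "AE" statement holds. *)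
definition nef_generators :: "real measure set" where
  "nef_generators =
     {\<nu>. radon_measure \<nu> \<and> Theta \<nu> \<noteq> {} \<and> \<not> (\<exists>c. AE x in \<nu>. x = c)}"

definition cumulant :: "real measure \<Rightarrow> real \<Rightarrow> real" where
  "cumulant \<nu> \<theta> = ln (enn2real (laplace \<nu> \<theta>))"

definition nef_member :: "real measure \<Rightarrow> real \<Rightarrow> real measure" where
  "nef_member \<nu> \<theta> = density \<nu> (\<lambda>x. ennreal (exp (\<theta> * x - cumulant \<nu> \<theta>)))"

definition nef :: "real measure \<Rightarrow> real measure set" where
  "nef \<nu> = nef_member \<nu> ` Theta \<nu>"

(* The domain of the means, the member with given mean and the variance function are
   attached to the family F = nef \<nu>, but are written through a generator \<nu>; they do not
   depend on which generator of F is used. *)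
definition mean_domain :: "real measure \<Rightarrow> real set" where
  "mean_domain \<nu> = deriv (cumulant \<nu>) ` Theta \<nu>"

definition psi :: "real measure \<Rightarrow> real \<Rightarrow> real" where
  "psi \<nu> = the_inv_into (Theta \<nu>) (deriv (cumulant \<nu>))"

definition member_of_mean :: "real measure \<Rightarrow> real \<Rightarrow> real measure" where
  "member_of_mean \<nu> m = nef_member \<nu> (psi \<nu> m)"

definition variance_function :: "real measure \<Rightarrow> real \<Rightarrow> real" where
  "variance_function \<nu> m = (\<integral> x. (x - m)\<^sup>2 \<partial>member_of_mean \<nu> m)"

definition cubic_nef :: "real measure \<Rightarrow> bool" where
  "cubic_nef \<nu> \<longleftrightarrow>
     (\<exists>p :: real poly. degree p \<le> 3 \<and> (\<forall>m \<in> mean_domain \<nu>. variance_function \<nu> m = poly p m))"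

(* As usual for orthogonal polynomials, the n-th member of a family has degree exactly n.
   Without this convention the constant family Q 0 = 1, Q n = 0 (n > 0), whose generating
   function is exp 0, would be 2-orthogonal for every probability measure. *)
definition polynomial_family :: "(nat \<Rightarrow> real poly) \<Rightarrow> bool" where
  "polynomial_family Q \<longleftrightarrow> (\<forall>n. degree (Q n) = n)"

definition has_all_moments :: "real measure \<Rightarrow> bool" where
  "has_all_moments \<mu> \<longleftrightarrow> (\<forall>n::nat. (\<integral>\<^sup>+ x. ennreal (\<bar>x\<bar> ^ n) \<partial>\<mu>) < \<infinity>)"

definition two_orthogonal :: "real measure \<Rightarrow> (nat \<Rightarrow> real poly) \<Rightarrow> bool" where
  "two_orthogonal \<mu> Q \<longleftrightarrow>
     has_all_moments \<mu> \<and> polynomial_family Q \<and>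
     (\<forall>n\<ge>1. \<forall>q\<ge>1. 2 * q \<le> n \<longrightarrow> (\<integral> x. poly (Q n) x * poly (Q q) x \<partial>\<mu>) = 0) \<and>
     (\<forall>n\<ge>1. (\<integral> x. poly (Q n) x \<partial>\<mu>) = 0)"

definition real_analytic_on :: "(real \<Rightarrow> real) \<Rightarrow> real set \<Rightarrow> bool" where
  "real_analytic_on f S \<longleftrightarrow>
     (\<forall>x\<^sub>0\<in>S. \<exists>\<epsilon>>0. \<exists>c :: nat \<Rightarrow> real.
        \<forall>x. \<bar>x - x\<^sub>0\<bar> < \<epsilon> \<longrightarrow> (\<lambda>n. c n * (x - x\<^sub>0) ^ n) sums f x)"

definition exponential_gf :: "(nat \<Rightarrow> real poly) \<Rightarrow> bool" where
  "exponential_gf Q \<longleftrightarrow>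
     (\<exists>r>0. \<exists>a b. real_analytic_on a {-r<..<r} \<and> real_analytic_on b {-r<..<r} \<and>
        (\<forall>z\<in>{-r<..<r}. \<forall>x. (\<lambda>n. poly (Q n) x * (z ^ n / fact n)) sums exp (a z * x + b z)))"

end

theory Submission
  imports Defs "HOL-Complex_Analysis.Complex_Analysis"
begin

text \<open>
  Let \<open>\<mu>\<close> be the member of the family with parameter \<open>\<theta>\<^sub>0\<close> and mean \<open>m\<^sub>0\<close>. A function
  \<open>exp (a(z) x + b(z))\<close> of total \<open>\<mu>\<close>-mass one is the density with respect to \<open>\<mu>\<close> of another member,
  the one with parameter \<open>\<theta>\<^sub>0 + a(z)\<close>. Integrating an exponential generating function against
  a polynomial \<open>g\<close> therefore gives, on the one hand, the power series with coefficients
  \<open>(\<integral> Q\<^sub>n g d\<mu>)/n!\<close> and, on the other hand, the expectation of \<open>g\<close> under the tilted measure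
  (\<open>exponential_gf_moments\<close>; the exchange of sum and integral is \<open>exponential_gf_integral\<close>).
  So 2-orthogonality says that expectations of the \<open>Q\<^sub>q\<close> under the tilted measure are polynomials
  in \<open>z\<close> of degree less than \<open>2q\<close>.

  If the \<open>Q\<^sub>n\<close> exist, the cases \<open>q = 1\<close> and \<open>q = 2\<close> already show that the mean of the tilted measure
  is affine in \<open>z\<close> and its second moment a polynomial of degree at most \<open>3\<close> in \<open>z\<close>. Hence the
  variance is a cubic polynomial of the mean near \<open>m\<^sub>0\<close>, and by analytic continuation of the Laplace
  transform to a strip (\<open>var_eq_poly_mean_extends\<close>) on the whole domain of the means.

  Conversely, let the variance be a polynomial \<open>p\<close> of degree at most \<open>3\<close> in the mean \<open>m\<close>. The
  moments \<open>E\<^sub>j\<close> of the members satisfy \<open>E\<^sub>j\<^sub>+\<^sub>1 = m E\<^sub>j + p dE\<^sub>j/dm\<close>, so \<open>E\<^sub>j\<close> is a polynomial in \<open>m\<close>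
  of degree at most \<open>2j - 1\<close> for \<open>j \<ge> 1\<close> (\<open>moment_ratio_eq_poly_mean\<close>). The family parametrized by
  \<open>z = m - m\<^sub>0\<close> has densities of the form \<open>exp (a(z) x + b(z))\<close> with \<open>a\<close> and \<open>b\<close> primitives of rational
  functions (\<open>mean_parametrization\<close>), and their Taylor coefficients in \<open>z\<close> are polynomials in \<open>x\<close> of
  the right degrees (\<open>exponential_polynomial_family\<close>); the degree bound for the moments is
  exactly their 2-orthogonality.
\<close>

section \<open>Power series and exchange of sum and integral\<close>

lemma real_power_series_unique:
  fixes c d :: "nat \<Rightarrow> real"
  assumes r: "r > 0"
    and c: "\<And>z. \<bar>z\<bar> < r \<Longrightarrow> (\<lambda>n. c n * z ^ n) sums f z"
    and d: "\<And>z. \<bar>z\<bar> < r \<Longrightarrow> (\<lambda>n. d n * z ^ n) sums f z"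
  shows "c = d"
proof (rule ccontr)
  assume "c \<noteq> d"
  then obtain m where m: "c m - d m \<noteq> 0" by (auto simp: fun_eq_iff)
  have diff: "(\<lambda>n. (c n - d n) * z ^ n) sums 0" if "\<bar>z\<bar> < r" for z
    using sums_diff[OF c[OF that] d[OF that]] by (simp add: algebra_simps)
  have "c 0 - d 0 = 0" using diff[of 0] r by (simp add: powser_sums_zero_iff[of "\<lambda>n. c n - d n"])
  then have "m > 0" using m by (cases m) auto
  obtain s where s: "0 < s" "\<And>z::real. z \<in> cball 0 s - {0} \<Longrightarrow> (0::real) \<noteq> 0"
    by (rule powser_0_nonzero[OF r, of "0::real" "\<lambda>n. c n - d n" "\<lambda>_. 0", OF _ refl m \<open>m > 0\<close>])
      (use diff in auto)
  then show False using s(2)[of s] by simp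
qed

text \<open>
  A geometric series times one fixed integrable function is the form in which domination is
  available both for generating functions, by Cauchy's inequality, and for the expansion of the
  Laplace transform, by exponential moments.
\<close>

lemma sums_integral_geometric:
  fixes f :: "nat \<Rightarrow> real \<Rightarrow> 'b :: {banach, second_countable_topology}"
  assumes meas: "\<And>n. f n \<in> borel_measurable M"
    and g: "integrable M g" and q: "0 \<le> q" "q < 1"
    and bound: "\<And>n x. norm (f n x) \<le> q ^ n * g x"
    and sums: "\<And>x. (\<lambda>n. f n x) sums s x"
  shows "(\<lambda>n. \<integral>x. f n x \<partial>M) sums (\<integral>x. s x \<partial>M)"
proof -
  have qs: "summable (\<lambda>n. q ^ n)" using q by (simp add: summable_geometric)
  have g0: "g x \<ge> 0" for x using order_trans[OF norm_ge_zero bound[of 0 x]] by simp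
  have int: "integrable M (f n)" for n
    by (rule Bochner_Integration.integrable_bound[of M "\<lambda>x. q ^ n * g x"])
      (use g meas bound g0 q in auto)
  have "summable (\<lambda>n. \<integral>x. norm (f n x) \<partial>M)"
  proof (rule summable_comparison_test'[where N = 0])
    show "summable (\<lambda>n. q ^ n * (\<integral>x. g x \<partial>M))" using qs by (rule summable_mult2)
    show "norm (\<integral>x. norm (f n x) \<partial>M) \<le> q ^ n * (\<integral>x. g x \<partial>M)" for n
    proof -
      have "(\<integral>x. norm (f n x) \<partial>M) \<le> (\<integral>x. q ^ n * g x \<partial>M)"
        by (rule integral_mono) (use int g bound in auto)
      then show ?thesis by simp
    qed
  qed
  moreover have "summable (\<lambda>n. norm (f n x))" for x
    by (rule summable_comparison_test'[where N = 0 and g = "\<lambda>n. q ^ n * g x"])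
      (use qs bound in \<open>auto intro: summable_mult2\<close>)
  ultimately have "(\<lambda>n. \<integral>x. f n x \<partial>M) sums (\<integral>x. (\<Sum>n. f n x) \<partial>M)"
    by (intro sums_integral int) auto
  then show ?thesis using sums by (simp add: sums_iff)
qed

lemma poly_le_exp_abs:
  fixes p :: "real poly"
  assumes "\<epsilon> > 0"
  obtains C where "C \<ge> 0" "\<And>x. \<bar>poly p x\<bar> \<le> C * exp (\<epsilon> * \<bar>x\<bar>)"
proof -
  have "\<exists>C\<ge>0. \<forall>x. \<bar>poly p x\<bar> \<le> C * exp (\<epsilon> * \<bar>x\<bar>)"
    using assms
  proof (induction p arbitrary: \<epsilon>)
    case 0
    then show ?case by (auto intro!: exI[of _ 0])
  next
    case (pCons c p)
    from pCons.IH[of "\<epsilon> / 2"] pCons.prems obtain C where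
      C: "C \<ge> 0" "\<And>x. \<bar>poly p x\<bar> \<le> C * exp (\<epsilon> / 2 * \<bar>x\<bar>)" by auto
    show ?case
    proof (intro exI[of _ "\<bar>c\<bar> + 2 / \<epsilon> * C"] conjI allI)
      show "0 \<le> \<bar>c\<bar> + 2 / \<epsilon> * C" using pCons.prems C(1) by simp
      fix x :: real
      have "\<epsilon> / 2 * \<bar>x\<bar> \<le> exp (\<epsilon> / 2 * \<bar>x\<bar>)"
        using exp_ge_add_one_self[of "\<epsilon> / 2 * \<bar>x\<bar>"] by linarith
      then have x: "\<bar>x\<bar> \<le> 2 / \<epsilon> * exp (\<epsilon> / 2 * \<bar>x\<bar>)"
        using pCons.prems by (simp add: field_simps)
      have "\<bar>x * poly p x\<bar> \<le> (2 / \<epsilon> * exp (\<epsilon> / 2 * \<bar>x\<bar>)) * (C * exp (\<epsilon> / 2 * \<bar>x\<bar>))"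
        unfolding abs_mult by (intro mult_mono x C) (use pCons.prems in auto)
      also have "\<dots> = 2 / \<epsilon> * C * exp (\<epsilon> * \<bar>x\<bar>)"
        by (simp flip: exp_add)
      finally have "\<bar>x * poly p x\<bar> \<le> 2 / \<epsilon> * C * exp (\<epsilon> * \<bar>x\<bar>)" .
      moreover have "\<bar>c\<bar> * 1 \<le> \<bar>c\<bar> * exp (\<epsilon> * \<bar>x\<bar>)"
        by (intro mult_left_mono) (use pCons.prems in auto)
      moreover have "\<bar>poly (pCons c p) x\<bar> \<le> \<bar>c\<bar> + \<bar>x * poly p x\<bar>" by simp
      ultimately show "\<bar>poly (pCons c p) x\<bar> \<le> (\<bar>c\<bar> + 2 / \<epsilon> * C) * exp (\<epsilon> * \<bar>x\<bar>)"
        by (simp add: algebra_simps)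
    qed
  qed
  then show ?thesis using that by blast
qed

section \<open>Integrating an exponential generating function\<close>

lemma real_analytic_complex_extension:
  assumes "real_analytic_on f {-r<..<r}" "r > 0"
  obtains F \<epsilon> where "0 < \<epsilon>" "\<epsilon> \<le> r" "F holomorphic_on ball 0 \<epsilon>"
    "\<And>x. \<bar>x\<bar> < \<epsilon> \<Longrightarrow> F (of_real x) = complex_of_real (f x)"
proof -
  have "0 \<in> {-r<..<r}" using assms by simp
  from bspec[OF assms(1)[unfolded real_analytic_on_def] this]
  obtain \<epsilon>' c where *: "\<epsilon>' > 0" "\<And>x. \<bar>x\<bar> < \<epsilon>' \<Longrightarrow> (\<lambda>n. c n * x ^ n) sums f x"
    by auto
  define \<epsilon> where "\<epsilon> = min \<epsilon>' r"
  define F where "F z = (\<Sum>n. complex_of_real (c n) * z ^ n)" for z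
  have summ: "summable (\<lambda>n. complex_of_real (c n) * z ^ n)" if z: "norm z < \<epsilon>" for z
  proof -
    obtain y where y: "norm z < y" "y < \<epsilon>" using dense[OF z] by auto
    have "\<bar>y\<bar> < \<epsilon>'" using y norm_ge_zero[of z] unfolding \<epsilon>_def by linarith
    then have "summable (\<lambda>n. c n * y ^ n)" using *(2) sums_summable by blast
    then have "summable (\<lambda>n. complex_of_real (c n) * of_real y ^ n)"
      by (simp flip: of_real_power of_real_mult)
    then have "summable (\<lambda>n. norm (complex_of_real (c n) * z ^ n))"
      by (rule powser_insidea) (use y in auto)
    then show ?thesis by (rule summable_norm_cancel)
  qed
  show ?thesis
  proof
    show "0 < \<epsilon>" "\<epsilon> \<le> r" using * assms by (auto simp: \<epsilon>_def)
    show "F holomorphic_on ball 0 \<epsilon>"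
      by (rule power_series_holomorphic[of _ _ "\<lambda>n. of_real (c n)"])
        (use summ in \<open>auto simp: F_def intro!: summable_sums\<close>)
    fix x :: real assume "\<bar>x\<bar> < \<epsilon>"
    then have "(\<lambda>n. complex_of_real (c n * x ^ n)) sums of_real (f x)"
      by (intro sums_of_real *) (auto simp: \<epsilon>_def)
    then show "F (of_real x) = complex_of_real (f x)" by (simp add: F_def sums_iff)
  qed
qed

lemma real_analytic_Re_holomorphic:
  assumes "F holomorphic_on ball 0 R" "r \<le> R"
  shows "real_analytic_on (\<lambda>x. Re (F (of_real x))) {-r<..<r}"
  unfolding real_analytic_on_def
proof (intro ballI)
  fix x0 :: real assume x0: "x0 \<in> {-r<..<r}"
  let ?\<epsilon> = "R - \<bar>x0\<bar>"
  let ?c = "\<lambda>n. Re ((deriv ^^ n) F (of_real x0) / fact n)"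
  have sub: "ball (complex_of_real x0) ?\<epsilon> \<subseteq> ball 0 R"
    by (subst ball_subset_ball_iff) (simp add: dist_norm)
  have "(\<lambda>n. ?c n * (x - x0) ^ n) sums Re (F (of_real x))" if "\<bar>x - x0\<bar> < ?\<epsilon>" for x
  proof -
    have "complex_of_real x \<in> ball (of_real x0) ?\<epsilon>"
      using that by (simp add: dist_norm abs_minus_commute flip: of_real_diff)
    then have "(\<lambda>n. (deriv ^^ n) F (of_real x0) / fact n * (of_real x - of_real x0) ^ n)
        sums F (of_real x)"
      by (rule holomorphic_power_series[OF holomorphic_on_subset[OF assms(1) sub]])
    from sums_Re[OF this] show ?thesis
      by (simp only: flip: of_real_diff of_real_power) (simp only: times_complex.sel
        Re_complex_of_real Im_complex_of_real mult_zero_right diff_zero)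
  qed
  then show "\<exists>\<epsilon>>0. \<exists>c. \<forall>x. \<bar>x - x0\<bar> < \<epsilon> \<longrightarrow> (\<lambda>n. c n * (x - x0) ^ n) sums Re (F (of_real x))"
    using x0 assms(2) by (intro exI[of _ ?\<epsilon>] conjI exI[of _ ?c]) auto
qed

text \<open>
  For fixed \<open>x\<close> the coefficients \<open>Q\<^sub>n(x)/n!\<close> are the Taylor coefficients at \<open>0\<close> of
  \<open>z \<mapsto> exp (a(z) x + b(z))\<close>, with \<open>a\<close> and \<open>b\<close> extended to a complex disc that does not depend on
  \<open>x\<close>. Since \<open>a(0) = 0\<close>, the disc can be shrunk until \<open>\<bar>a\<bar> < t/2\<close> on it, and Cauchy's inequality
  on a circle of radius \<open>\<rho>\<close> bounds \<open>\<bar>Q\<^sub>n(x)\<bar>/n!\<close> by \<open>exp (t\<bar>x\<bar>/2 + K) / \<rho>\<^sup>n\<close>. The other half of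
  \<open>t\<close> pays for the polynomial factor \<open>p\<close>.
\<close>

lemma exponential_gf_integral:
  fixes a b :: "real \<Rightarrow> real" and Q :: "nat \<Rightarrow> real poly"
  assumes r: "r > 0" and a: "real_analytic_on a {-r<..<r}" and b: "real_analytic_on b {-r<..<r}"
    and gf: "\<And>z x. z \<in> {-r<..<r} \<Longrightarrow> (\<lambda>n. poly (Q n) x * (z ^ n / fact n)) sums exp (a z * x + b z)"
    and a0: "a 0 = 0"
    and sets: "sets M = sets borel" and t: "t > 0" and int: "integrable M (\<lambda>x. exp (t * \<bar>x\<bar>))"
  obtains \<rho> where "0 < \<rho>" "\<rho> \<le> r" "\<And>z. \<bar>z\<bar> < \<rho> \<Longrightarrow> \<bar>a z\<bar> < t"
    "\<And>z p. \<bar>z\<bar> < \<rho> \<Longrightarrow> (\<lambda>n. (\<integral>x. poly (Q n) x * poly p x \<partial>M) / fact n * z ^ n)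
        sums (\<integral>x. exp (a z * x + b z) * poly p x \<partial>M)"
proof -
  obtain A \<epsilon>1 where A: "0 < \<epsilon>1" "\<epsilon>1 \<le> r" "A holomorphic_on ball 0 \<epsilon>1"
    "\<And>x. \<bar>x\<bar> < \<epsilon>1 \<Longrightarrow> A (of_real x) = complex_of_real (a x)"
    using real_analytic_complex_extension[OF a r] by blast
  obtain B \<epsilon>2 where B: "0 < \<epsilon>2" "\<epsilon>2 \<le> r" "B holomorphic_on ball 0 \<epsilon>2"
    "\<And>x. \<bar>x\<bar> < \<epsilon>2 \<Longrightarrow> B (of_real x) = complex_of_real (b x)"
    using real_analytic_complex_extension[OF b r] by blast
  have cont: "isCont A 0" "isCont B 0"
    using A(1,3) B(1,3) holomorphic_on_imp_continuous_on continuous_on_interior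
    by (metis centre_in_ball interior_ball)+
  have "A 0 = 0" using A(4)[of 0] A(1) a0 by simp
  have lim: "((\<lambda>z. norm (f z)) \<longlongrightarrow> norm (f 0)) (nhds 0)" if "isCont f 0" for f :: "complex \<Rightarrow> complex"
    using that unfolding isCont_def tendsto_at_iff_tendsto_nhds by (rule tendsto_norm)
  have "\<forall>\<^sub>F z in nhds 0. norm (A z) < t / 2"
    by (rule order_tendstoD(2)[OF lim[OF cont(1)]]) (use \<open>A 0 = 0\<close> t in simp)
  moreover have "\<forall>\<^sub>F z in nhds 0. norm (B z) < norm (B 0) + 1"
    by (rule order_tendstoD(2)[OF lim[OF cont(2)]]) simp
  ultimately have "\<forall>\<^sub>F z in nhds 0. norm (A z) < t / 2 \<and> norm (B z) < norm (B 0) + 1"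
    by (rule eventually_conj)
  then obtain \<delta> where \<delta>: "\<delta> > 0" "\<And>z. norm z < \<delta> \<Longrightarrow> norm (A z) < t / 2"
     "\<And>z. norm z < \<delta> \<Longrightarrow> norm (B z) < norm (B 0) + 1"
    by (auto simp: eventually_nhds_metric)
  define K where "K = norm (B 0) + 1"
  \<comment> \<open>Halving makes the closed disc of radius \<open>\<rho>\<close> fit into all three open discs, as Cauchy's inequality needs.\<close>
  define \<rho> where "\<rho> = min (min \<epsilon>1 \<epsilon>2) \<delta> / 2"
  have \<rho>: "0 < \<rho>" "\<rho> < \<epsilon>1" "\<rho> < \<epsilon>2" "\<rho> < \<delta>" using A B \<delta> by (auto simp: \<rho>_def)
  define h where "h x z = exp (A z * of_real x + B z)" for x :: real and z
  have holh: "h x holomorphic_on ball 0 (min \<epsilon>1 \<epsilon>2)" for x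
    unfolding h_def by (intro holomorphic_intros holomorphic_on_subset[OF A(3)]
        holomorphic_on_subset[OF B(3)]) auto
  have coeff: "poly (Q n) x / fact n = Re ((deriv ^^ n) (h x) 0 / fact n)" for n x
  proof -
    have "(\<lambda>n. poly (Q n) x / fact n) = (\<lambda>n. Re ((deriv ^^ n) (h x) 0 / fact n))"
    proof (rule real_power_series_unique[where f = "\<lambda>z. exp (a z * x + b z)"])
      show "0 < min \<epsilon>1 \<epsilon>2" using A B by simp
      fix z :: real assume z: "\<bar>z\<bar> < min \<epsilon>1 \<epsilon>2"
      then show "(\<lambda>n. poly (Q n) x / fact n * z ^ n) sums exp (a z * x + b z)"
        using gf[of z x] A B by (simp add: abs_less_iff)
      have "(\<lambda>n. (deriv ^^ n) (h x) 0 / fact n * (of_real z - 0) ^ n) sums h x (of_real z)"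
        by (rule holomorphic_power_series[OF holh]) (use z in simp)
      from sums_Re[OF this] have "(\<lambda>n. Re ((deriv ^^ n) (h x) 0 / fact n) * z ^ n) sums Re (h x (of_real z))"
        by (simp only: diff_zero flip: of_real_power) (simp only: times_complex.sel
          Re_complex_of_real Im_complex_of_real mult_zero_right diff_zero)
      moreover have "h x (of_real z) = of_real (exp (a z * x + b z))"
        using z by (simp add: h_def A B exp_of_real flip: of_real_mult of_real_add)
      ultimately show "(\<lambda>n. Re ((deriv ^^ n) (h x) 0 / fact n) * z ^ n) sums exp (a z * x + b z)"
        by simp
    qed
    then show ?thesis by metis
  qed
  have bound: "\<bar>poly (Q n) x / fact n\<bar> \<le> exp (t / 2 * \<bar>x\<bar> + K) / \<rho> ^ n" for n x
  proof -
    have "norm ((deriv ^^ n) (h x) 0) \<le> fact n * exp (t / 2 * \<bar>x\<bar> + K) / \<rho> ^ n"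
    proof (rule Cauchy_inequality)
      show "h x holomorphic_on ball 0 \<rho>" "continuous_on (cball 0 \<rho>) (h x)"
        using \<rho> by (auto intro!: holomorphic_on_imp_continuous_on holomorphic_on_subset[OF holh])
      fix z :: complex assume "norm (0 - z) = \<rho>"
      then have z: "norm z < \<delta>" using \<rho> by simp
      have "Re (A z * of_real x + B z) \<le> norm (A z * of_real x + B z)" by (rule complex_Re_le_cmod)
      also have "\<dots> \<le> norm (A z) * \<bar>x\<bar> + norm (B z)"
        by (rule order_trans[OF norm_triangle_ineq]) (simp add: norm_mult)
      also have "\<dots> \<le> t / 2 * \<bar>x\<bar> + K"
        using \<delta>(2,3)[OF z] by (intro add_mono mult_right_mono) (auto simp: K_def)
      finally show "norm (h x z) \<le> exp (t / 2 * \<bar>x\<bar> + K)" by (simp add: h_def)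
    qed (use \<rho> in auto)
    then have "norm ((deriv ^^ n) (h x) 0 / fact n) \<le> exp (t / 2 * \<bar>x\<bar> + K) / \<rho> ^ n"
      by (simp add: norm_divide pos_divide_le_eq mult.commute)
    then show ?thesis unfolding coeff using abs_Re_le_cmod order_trans by blast
  qed
  show ?thesis
  proof
    show "0 < \<rho>" "\<rho> \<le> r" using \<rho> A by auto
    fix z :: real assume z: "\<bar>z\<bar> < \<rho>"
    have "norm (A (of_real z)) < t / 2" using z \<rho> by (intro \<delta>) simp
    moreover have "A (of_real z) = of_real (a z)" using z \<rho> A by simp
    ultimately show "\<bar>a z\<bar> < t" using t by simp
    fix p :: "real poly"
    obtain C where C: "C \<ge> 0" "\<And>x. \<bar>poly p x\<bar> \<le> C * exp (t / 2 * \<bar>x\<bar>)"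
      using poly_le_exp_abs[of "t / 2" p] t by auto
    have "(\<lambda>n. \<integral>x. poly (Q n) x / fact n * z ^ n * poly p x \<partial>M)
        sums (\<integral>x. exp (a z * x + b z) * poly p x \<partial>M)"
    proof (rule sums_integral_geometric)
      show "(\<lambda>x. poly (Q n) x / fact n * z ^ n * poly p x) \<in> borel_measurable M" for n
        by (simp add: measurable_cong_sets[OF sets refl] borel_measurable_continuous_onI continuous_intros)
      show "integrable M (\<lambda>x. exp K * C * exp (t * \<bar>x\<bar>))" using int by simp
      show "0 \<le> \<bar>z\<bar> / \<rho>" "\<bar>z\<bar> / \<rho> < 1" using z by auto
      fix x
      show "norm (poly (Q n) x / fact n * z ^ n * poly p x) \<le> (\<bar>z\<bar> / \<rho>) ^ n * (exp K * C * exp (t * \<bar>x\<bar>))" for n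
      proof -
        have "norm (poly (Q n) x / fact n * z ^ n * poly p x)
            = \<bar>poly (Q n) x / fact n\<bar> * \<bar>z\<bar> ^ n * \<bar>poly p x\<bar>"
          by (simp add: abs_mult power_abs)
        also have "\<dots> \<le> exp (t / 2 * \<bar>x\<bar> + K) / \<rho> ^ n * \<bar>z\<bar> ^ n * (C * exp (t / 2 * \<bar>x\<bar>))"
          by (intro mult_mono bound C) (use \<rho> in auto)
        also have "\<dots> = (\<bar>z\<bar> / \<rho>) ^ n * (exp K * C * exp (t / 2 * \<bar>x\<bar> + t / 2 * \<bar>x\<bar>))"
          by (simp only: exp_add power_divide times_divide_eq_left times_divide_eq_right mult_ac)
        finally show ?thesis by simp
      qed
      have "(\<lambda>n. poly (Q n) x * (z ^ n / fact n) * poly p x) sums (exp (a z * x + b z) * poly p x)"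
        using z \<rho> A by (intro sums_mult2 gf) auto
      then show "(\<lambda>n. poly (Q n) x / fact n * z ^ n * poly p x) sums (exp (a z * x + b z) * poly p x)"
        by (simp add: mult_ac)
    qed
    moreover have "(\<integral>x. poly (Q n) x / fact n * z ^ n * poly p x \<partial>M)
        = (\<integral>x. poly (Q n) x * poly p x \<partial>M) / fact n * z ^ n" for n
    proof -
      have "(\<integral>x. poly (Q n) x / fact n * z ^ n * poly p x \<partial>M)
          = (\<integral>x. (z ^ n / fact n) * (poly (Q n) x * poly p x) \<partial>M)"
        by (intro Bochner_Integration.integral_cong) auto
      then show ?thesis by simp
    qed
    ultimately show "(\<lambda>n. (\<integral>x. poly (Q n) x * poly p x \<partial>M) / fact n * z ^ n)
        sums (\<integral>x. exp (a z * x + b z) * poly p x \<partial>M)" by simp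
  qed
qed

section \<open>Moments of the measures of an exponential family\<close>

text \<open>
  \<open>moment \<nu> j\<close> is the \<open>j\<close>-th derivative of the Laplace transform of \<open>\<nu>\<close>; the member of the family
  with parameter \<open>\<theta>\<close> has \<open>j\<close>-th moment \<open>moment \<nu> j \<theta> / moment \<nu> 0 \<theta>\<close>. Its holomorphic version
  \<open>cmoment\<close> lives on the strip over the parameter interval and is used for analytic continuation.
\<close>

definition moment :: "real measure \<Rightarrow> nat \<Rightarrow> real \<Rightarrow> real" where
  "moment \<nu> j \<theta> = (\<integral>x. x ^ j * exp (\<theta> * x) \<partial>\<nu>)"

definition cmoment :: "real measure \<Rightarrow> nat \<Rightarrow> complex \<Rightarrow> complex" where
  "cmoment \<nu> j z = (\<integral>x. of_real x ^ j * exp (z * of_real x) \<partial>\<nu>)"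

definition mean :: "real measure \<Rightarrow> real \<Rightarrow> real" where
  "mean \<nu> \<theta> = moment \<nu> 1 \<theta> / moment \<nu> 0 \<theta>"

definition var :: "real measure \<Rightarrow> real \<Rightarrow> real" where
  "var \<nu> \<theta> = moment \<nu> 2 \<theta> / moment \<nu> 0 \<theta> - (mean \<nu> \<theta>)\<^sup>2"

lemma power_div_fact_le_exp:
  fixes y :: real
  assumes "y \<ge> 0"
  shows "y ^ n / fact n \<le> exp y"
proof -
  have s: "(\<lambda>n. y ^ n / fact n) sums exp y"
    using exp_converges[of y] by (simp add: divide_inverse mult.commute)
  have "(\<Sum>k\<in>{n}. y ^ k / fact k) \<le> (\<Sum>k. y ^ k / fact k)"
    by (rule sum_le_suminf) (use s assms in \<open>auto simp: sums_iff\<close>)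
  then show ?thesis using s by (simp add: sums_iff)
qed

locale nef_generator =
  fixes \<nu> :: "real measure"
  assumes generator: "\<nu> \<in> nef_generators"
begin

lemma sets_nu [measurable_cong]: "sets \<nu> = sets borel"
  using generator by (simp add: nef_generators_def radon_measure_def)

lemma not_AE_const: "\<not> (AE x in \<nu>. x = c)"
  using generator by (auto simp: nef_generators_def)

lemma open_Theta: "open (Theta \<nu>)"
  by (simp add: Theta_def)

lemma convex_Theta: "convex (Theta \<nu>)"
proof -
  have "laplace \<nu> t < \<infinity>" if "laplace \<nu> t1 < \<infinity>" "laplace \<nu> t2 < \<infinity>" "t1 \<le> t" "t \<le> t2" for t t1 t2
  proof -
    have le: "exp (t * x) \<le> exp (t1 * x) + exp (t2 * x)" for x
    proof (cases "x \<ge> 0")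
      case True
      then have "exp (t * x) \<le> exp (t2 * x)" using that by (simp add: mult_right_mono)
      then show ?thesis using exp_ge_zero[of "t1 * x"] by linarith
    next
      case False
      then have "exp (t * x) \<le> exp (t1 * x)" using that by (simp add: mult_right_mono_neg)
      then show ?thesis using exp_ge_zero[of "t2 * x"] by linarith
    qed
    have "laplace \<nu> t \<le> (\<integral>\<^sup>+ x. ennreal (exp (t1 * x)) + ennreal (exp (t2 * x)) \<partial>\<nu>)"
      unfolding laplace_def by (intro nn_integral_mono) (use le in \<open>simp flip: ennreal_plus\<close>)
    also have "\<dots> = laplace \<nu> t1 + laplace \<nu> t2"
      unfolding laplace_def by (intro nn_integral_add) measurable
    also have "\<dots> < \<infinity>" using that by simp
    finally show ?thesis .
  qed
  then have "is_interval {\<theta>. laplace \<nu> \<theta> < \<infinity>}"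
    unfolding is_interval_1 by blast
  then show ?thesis unfolding Theta_def by (intro convex_interior) (simp add: is_interval_convex_1)
qed

lemma integrable_exp_Theta: "\<theta> \<in> Theta \<nu> \<Longrightarrow> integrable \<nu> (\<lambda>x. exp (\<theta> * x))"
  by (intro integrableI_nonneg) (use interior_subset in \<open>auto simp: Theta_def laplace_def\<close>)

text \<open>
  The parameter set is open, so both \<open>\<theta> + \<delta>\<close> and \<open>\<theta> - \<delta>\<close> are still parameters: the members of
  the family have two-sided exponential moments, hence all moments.
\<close>

lemma integrable_exp_abs_Theta:
  assumes "\<theta> \<in> Theta \<nu>"
  obtains \<delta> where "\<delta> > 0" "{\<theta> - \<delta>..\<theta> + \<delta>} \<subseteq> Theta \<nu>" "integrable \<nu> (\<lambda>x. exp (\<delta> * \<bar>x\<bar> + \<theta> * x))"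
proof -
  obtain \<delta> where \<delta>: "\<delta> > 0" "cball \<theta> \<delta> \<subseteq> Theta \<nu>"
    using open_Theta assms open_contains_cball by blast
  then have sub: "{\<theta> - \<delta>..\<theta> + \<delta>} \<subseteq> Theta \<nu>" by (simp add: cball_eq_atLeastAtMost)
  have "integrable \<nu> (\<lambda>x. exp (\<delta> * \<bar>x\<bar> + \<theta> * x))"
  proof (rule Bochner_Integration.integrable_bound)
    show "integrable \<nu> (\<lambda>x. exp ((\<theta> + \<delta>) * x) + exp ((\<theta> - \<delta>) * x))"
      using sub \<delta>(1) by (intro Bochner_Integration.integrable_add integrable_exp_Theta) auto
    have "exp (\<delta> * \<bar>x\<bar> + \<theta> * x) \<le> exp ((\<theta> + \<delta>) * x) + exp ((\<theta> - \<delta>) * x)" for x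
      using exp_ge_zero[of "(\<theta> + \<delta>) * x"] exp_ge_zero[of "(\<theta> - \<delta>) * x"]
      by (cases "x \<ge> 0") (simp_all add: algebra_simps del: exp_ge_zero)
    then show "AE x in \<nu>. norm (exp (\<delta> * \<bar>x\<bar> + \<theta> * x)) \<le> norm (exp ((\<theta> + \<delta>) * x) + exp ((\<theta> - \<delta>) * x))"
      by auto
  qed measurable
  then show ?thesis using that \<delta>(1) sub by blast
qed

lemma borel_measurable_poly [measurable]: "poly p \<in> borel_measurable borel" for p :: "real poly"
  by (intro borel_measurable_continuous_onI continuous_intros)

lemma integrable_poly_exp_Theta:
  assumes "\<theta> \<in> Theta \<nu>"
  shows "integrable \<nu> (\<lambda>x. poly p x * exp (\<theta> * x))"
proof -
  obtain \<delta> where \<delta>: "\<delta> > 0" "integrable \<nu> (\<lambda>x. exp (\<delta> * \<bar>x\<bar> + \<theta> * x))"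
    using integrable_exp_abs_Theta assms by blast
  obtain C where C: "C \<ge> 0" "\<And>x. \<bar>poly p x\<bar> \<le> C * exp (\<delta> * \<bar>x\<bar>)"
    using poly_le_exp_abs \<delta>(1) by blast
  show ?thesis
  proof (rule Bochner_Integration.integrable_bound)
    show "integrable \<nu> (\<lambda>x. C * exp (\<delta> * \<bar>x\<bar> + \<theta> * x))" using \<delta> by simp
    show "AE x in \<nu>. norm (poly p x * exp (\<theta> * x)) \<le> norm (C * exp (\<delta> * \<bar>x\<bar> + \<theta> * x))"
      using C by (auto simp: abs_mult exp_add mult.assoc[symmetric] intro!: mult_right_mono)
  qed measurable
qed

lemma integrable_power_exp_Theta:
  "\<theta> \<in> Theta \<nu> \<Longrightarrow> integrable \<nu> (\<lambda>x. x ^ j * exp (\<theta> * x))"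
  using integrable_poly_exp_Theta[of \<theta> "monom 1 j"] by (simp add: poly_monom)

lemma integral_poly_exp_Theta:
  assumes "\<theta> \<in> Theta \<nu>"
  shows "(\<integral>x. poly p x * exp (\<theta> * x) \<partial>\<nu>) = (\<Sum>i\<le>degree p. coeff p i * moment \<nu> i \<theta>)"
  unfolding poly_altdef moment_def sum_distrib_right mult.assoc
  by (subst Bochner_Integration.integral_sum) (use integrable_power_exp_Theta assms in auto)

lemma cmoment_of_real: "cmoment \<nu> j (of_real \<theta>) = of_real (moment \<nu> j \<theta>)"
proof -
  have "of_real x ^ j * exp (of_real \<theta> * of_real x) = complex_of_real (x ^ j * exp (\<theta> * x))" for x
    by (simp flip: exp_of_real)
  then show ?thesis by (simp only: cmoment_def moment_def integral_complex_of_real)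
qed

text \<open>
  Expanding \<open>exp (w x)\<close> under the integral. With \<open>\<delta>\<close> the exponential integrability margin,
  half of it controls \<open>x\<^sup>j\<close> and the other half the \<open>n\<close>-th term, because
  \<open>(\<delta>\<bar>x\<bar>/2)\<^sup>n / n! \<le> exp (\<delta>\<bar>x\<bar>/2)\<close>.
\<close>

lemma cmoment_sums:
  assumes "Re z \<in> Theta \<nu>"
  obtains \<delta> where "\<delta> > 0"
    "\<And>w. norm w < \<delta> \<Longrightarrow> (\<lambda>n. cmoment \<nu> (j + n) z / fact n * w ^ n) sums cmoment \<nu> j (z + w)"
proof -
  obtain \<delta> where \<delta>: "\<delta> > 0" "integrable \<nu> (\<lambda>x. exp (\<delta> * \<bar>x\<bar> + Re z * x))"
    using integrable_exp_abs_Theta assms by blast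
  obtain C where C: "C \<ge> 0" "\<And>x. \<bar>poly (monom 1 j) x\<bar> \<le> C * exp (\<delta> / 2 * \<bar>x\<bar>)"
    using poly_le_exp_abs[of "\<delta> / 2"] \<delta>(1) by auto
  have "(\<lambda>n. cmoment \<nu> (j + n) z / fact n * w ^ n) sums cmoment \<nu> j (z + w)" if w: "norm w < \<delta> / 2" for w
  proof -
    let ?f = "\<lambda>n x. complex_of_real x ^ (j + n) * exp (z * of_real x) * (w ^ n / fact n)"
    have "(\<lambda>n. \<integral>x. ?f n x \<partial>\<nu>) sums (\<integral>x. of_real x ^ j * exp ((z + w) * of_real x) \<partial>\<nu>)"
    proof (rule sums_integral_geometric)
      show "integrable \<nu> (\<lambda>x. C * exp (\<delta> * \<bar>x\<bar> + Re z * x))" using \<delta> by simp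
      show "0 \<le> norm w / (\<delta> / 2)" "norm w / (\<delta> / 2) < 1" using w \<delta> by auto
      fix x
      show "norm (?f n x) \<le> (norm w / (\<delta> / 2)) ^ n * (C * exp (\<delta> * \<bar>x\<bar> + Re z * x))" for n
      proof -
        have "norm (?f n x) = \<bar>x ^ j\<bar> * ((\<delta> / 2 * \<bar>x\<bar>) ^ n / fact n) * ((norm w / (\<delta> / 2)) ^ n * exp (Re z * x))"
          using \<delta> by (simp add: norm_mult norm_power norm_divide power_add power_abs field_simps)
        also have "\<dots> \<le> (C * exp (\<delta> / 2 * \<bar>x\<bar>)) * exp (\<delta> / 2 * \<bar>x\<bar>) * ((norm w / (\<delta> / 2)) ^ n * exp (Re z * x))"
          by (intro mult_mono power_div_fact_le_exp) (use C \<delta> in \<open>auto simp: poly_monom\<close>)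
        also have "\<dots> = (norm w / (\<delta> / 2)) ^ n * (C * exp (\<delta> / 2 * \<bar>x\<bar> + \<delta> / 2 * \<bar>x\<bar> + Re z * x))"
          by (simp only: exp_add mult_ac)
        finally show ?thesis by simp
      qed
      have "(\<lambda>n. (w * of_real x) ^ n / fact n) sums exp (w * of_real x)"
        using exp_converges[of "w * of_real x"] by (simp add: scaleR_conv_of_real divide_inverse mult.commute)
      then have "(\<lambda>n. complex_of_real x ^ j * exp (z * of_real x) * ((w * of_real x) ^ n / fact n))
          sums (complex_of_real x ^ j * exp (z * of_real x) * exp (w * of_real x))"
        by (rule sums_mult)
      then show "(\<lambda>n. ?f n x) sums (of_real x ^ j * exp ((z + w) * of_real x))"
        by (simp add: power_add power_mult_distrib exp_add algebra_simps)
    qed measurable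
    moreover have "(\<integral>x. ?f n x \<partial>\<nu>) = cmoment \<nu> (j + n) z / fact n * w ^ n" for n
      unfolding cmoment_def by (subst integral_mult_left_zero) simp
    ultimately show ?thesis by (simp add: cmoment_def)
  qed
  then show ?thesis using that[of "\<delta> / 2"] \<delta>(1) by auto
qed

lemma DERIV_cmoment:
  assumes "Re z \<in> Theta \<nu>"
  shows "(cmoment \<nu> j has_field_derivative cmoment \<nu> (Suc j) z) (at z)"
proof -
  let ?c = "\<lambda>n. cmoment \<nu> (j + n) z / fact n"
  obtain \<delta> where \<delta>: "\<delta> > 0"
    "\<And>w. norm w < \<delta> \<Longrightarrow> (\<lambda>n. ?c n * w ^ n) sums cmoment \<nu> j (z + w)"
    using cmoment_sums assms by blast
  have "((\<lambda>w. \<Sum>n. ?c n * w ^ n) has_field_derivative (\<Sum>n. diffs ?c n * 0 ^ n)) (at 0)"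
    by (rule termdiffs_strong'[where K = \<delta>]) (use \<delta> in \<open>auto simp: sums_iff\<close>)
  then have "((\<lambda>w. \<Sum>n. ?c n * w ^ n) has_field_derivative cmoment \<nu> (Suc j) z) (at 0)"
    by (simp add: diffs_def)
  then have "((\<lambda>w. cmoment \<nu> j (z + w)) has_field_derivative cmoment \<nu> (Suc j) z) (at 0)"
    by (rule has_field_derivative_transform_within_open[of _ _ _ "ball 0 \<delta>"])
      (use \<delta> in \<open>auto simp: sums_iff\<close>)
  then show ?thesis using DERIV_shift[of "cmoment \<nu> j" _ 0 z] by (simp add: add.commute)
qed

lemma DERIV_moment:
  assumes "\<theta> \<in> Theta \<nu>"
  shows "(moment \<nu> j has_real_derivative moment \<nu> (Suc j) \<theta>) (at \<theta>)"
proof -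
  have "((\<lambda>x. cmoment \<nu> j (of_real x)) has_vector_derivative cmoment \<nu> (Suc j) (of_real \<theta>)) (at \<theta>)"
    using assms by (intro has_vector_derivative_real_field DERIV_cmoment) simp
  from has_field_derivative_Re[OF this] show ?thesis by (simp add: cmoment_of_real)
qed

lemma moment_0_pos:
  assumes "\<theta> \<in> Theta \<nu>"
  shows "moment \<nu> 0 \<theta> > 0"
proof -
  have "moment \<nu> 0 \<theta> \<ge> 0" by (simp add: moment_def)
  moreover have "moment \<nu> 0 \<theta> \<noteq> 0"
  proof
    assume "moment \<nu> 0 \<theta> = 0"
    then have "AE x in \<nu>. exp (\<theta> * x) = 0"
      using integral_nonneg_eq_0_iff_AE[OF integrable_exp_Theta[OF assms]] by (simp add: moment_def)
    then have "AE x in \<nu>. x = 0" by (rule AE_mp) simp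
    then show False using not_AE_const by blast
  qed
  ultimately show ?thesis by simp
qed

lemma integral_square_Theta:
  assumes "\<theta> \<in> Theta \<nu>"
  shows "(\<integral>x. (x - m)\<^sup>2 * exp (\<theta> * x) \<partial>\<nu>) = moment \<nu> 2 \<theta> - 2 * m * moment \<nu> 1 \<theta> + m\<^sup>2 * moment \<nu> 0 \<theta>"
proof -
  have "(\<integral>x. (x - m)\<^sup>2 * exp (\<theta> * x) \<partial>\<nu>) = (\<integral>x. poly [:m\<^sup>2, - (2 * m), 1:] x * exp (\<theta> * x) \<partial>\<nu>)"
    by (intro Bochner_Integration.integral_cong) (auto simp: power2_eq_square algebra_simps)
  also have "\<dots> = moment \<nu> 2 \<theta> - 2 * m * moment \<nu> 1 \<theta> + m\<^sup>2 * moment \<nu> 0 \<theta>"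
    unfolding integral_poly_exp_Theta[OF assms] by (simp add: eval_nat_numeral)
  finally show ?thesis .
qed

lemma var_pos:
  assumes "\<theta> \<in> Theta \<nu>"
  shows "var \<nu> \<theta> > 0"
proof -
  let ?I = "\<integral>x. (x - mean \<nu> \<theta>)\<^sup>2 * exp (\<theta> * x) \<partial>\<nu>"
  have int: "integrable \<nu> (\<lambda>x. (x - mean \<nu> \<theta>)\<^sup>2 * exp (\<theta> * x))"
    using integrable_poly_exp_Theta[OF assms, of "[:- mean \<nu> \<theta>, 1:] ^ 2"] by (simp add: poly_power)
  have "?I \<ge> 0" by (intro integral_nonneg_AE) auto
  moreover have "?I \<noteq> 0"
  proof
    assume "?I = 0"
    then have "AE x in \<nu>. (x - mean \<nu> \<theta>)\<^sup>2 * exp (\<theta> * x) = 0"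
      using integral_nonneg_eq_0_iff_AE[OF int] by simp
    then show False using not_AE_const[of "mean \<nu> \<theta>"] by simp
  qed
  ultimately have "?I > 0" by linarith
  moreover have "?I = moment \<nu> 0 \<theta> * var \<nu> \<theta>"
    using moment_0_pos[OF assms] unfolding integral_square_Theta[OF assms] var_def mean_def
    by (simp add: field_simps power2_eq_square)
  ultimately show ?thesis using moment_0_pos[OF assms] by (simp add: zero_less_mult_iff)
qed

lemma cumulant_eq: "\<theta> \<in> Theta \<nu> \<Longrightarrow> cumulant \<nu> \<theta> = ln (moment \<nu> 0 \<theta>)"
  unfolding cumulant_def laplace_def moment_def
  by (subst nn_integral_eq_integral) (use integrable_exp_Theta in auto)

lemma DERIV_ln_moment:
  "\<theta> \<in> Theta \<nu> \<Longrightarrow> ((\<lambda>\<theta>. ln (moment \<nu> 0 \<theta>)) has_real_derivative mean \<nu> \<theta>) (at \<theta>)"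
  using moment_0_pos by (auto intro!: derivative_eq_intros DERIV_moment simp: mean_def)

lemma deriv_cumulant: 
  assumes "\<theta> \<in> Theta \<nu>"
  shows "deriv (cumulant \<nu>) \<theta> = mean \<nu> \<theta>"
proof -
  have "(cumulant \<nu> has_real_derivative mean \<nu> \<theta>) (at \<theta>)"
    by (rule has_field_derivative_transform_within_open[OF DERIV_ln_moment[OF assms] open_Theta assms])
      (simp add: cumulant_eq)
  then show ?thesis by (rule DERIV_imp_deriv)
qed

text \<open>
  The recurrence for the moments \<open>E\<^sub>j\<close> of the members: \<open>E\<^sub>j' = E\<^sub>j\<^sub>+\<^sub>1 - E\<^sub>j E\<^sub>1\<close>, the derivative being
  with respect to the canonical parameter.
\<close>

lemma DERIV_moment_ratio:
  assumes "\<theta> \<in> Theta \<nu>"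
  shows "((\<lambda>\<theta>. moment \<nu> j \<theta> / moment \<nu> 0 \<theta>) has_real_derivative
     moment \<nu> (Suc j) \<theta> / moment \<nu> 0 \<theta> - moment \<nu> j \<theta> / moment \<nu> 0 \<theta> * mean \<nu> \<theta>) (at \<theta>)"
  using moment_0_pos[OF assms]
  by (auto intro!: derivative_eq_intros DERIV_moment assms simp: mean_def field_simps)

lemma DERIV_mean: "\<theta> \<in> Theta \<nu> \<Longrightarrow> (mean \<nu> has_real_derivative var \<nu> \<theta>) (at \<theta>)"
  using DERIV_moment_ratio[of \<theta> 1]
  by (simp add: mean_def[abs_def] var_def power2_eq_square numeral_2_eq_2)

text \<open>
  The derivative of the mean is the variance, which is positive because \<open>\<nu>\<close> is not concentrated
  on one point.
\<close>

lemma strict_mono_on_mean: "strict_mono_on (Theta \<nu>) (mean \<nu>)"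
proof (rule strict_mono_onI)
  fix s t assume st: "s \<in> Theta \<nu>" "t \<in> Theta \<nu>" "s < t"
  then have "{s..t} \<subseteq> Theta \<nu>" using convex_Theta by (simp add: closed_segment_subset flip: closed_segment_eq_real_ivl1)
  then show "mean \<nu> s < mean \<nu> t"
    using DERIV_mean var_pos by (intro DERIV_pos_imp_increasing[OF st(3)]) (meson atLeastAtMost_iff subsetD)
qed

lemma inj_on_mean: "inj_on (mean \<nu>) (Theta \<nu>)"
  using strict_mono_on_mean by (rule strict_mono_on_imp_inj_on)

lemma integral_nef_member:
  fixes f :: "real \<Rightarrow> real"
  assumes "\<theta> \<in> Theta \<nu>" and [measurable]: "f \<in> borel_measurable borel"
  shows "(\<integral>x. f x \<partial>nef_member \<nu> \<theta>) = (\<integral>x. f x * exp (\<theta> * x) \<partial>\<nu>) / moment \<nu> 0 \<theta>"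
proof -
  have "(\<integral>x. f x \<partial>nef_member \<nu> \<theta>) = (\<integral>x. exp (\<theta> * x - cumulant \<nu> \<theta>) *\<^sub>R f x \<partial>\<nu>)"
    unfolding nef_member_def by (rule integral_density) auto
  also have "\<dots> = (\<integral>x. f x * exp (\<theta> * x) / moment \<nu> 0 \<theta> \<partial>\<nu>)"
    using moment_0_pos[OF assms(1)] by (simp add: cumulant_eq assms(1) exp_diff mult.commute)
  finally show ?thesis by simp
qed

lemma integrable_nef_member:
  fixes f :: "real \<Rightarrow> real"
  assumes "\<theta> \<in> Theta \<nu>" and [measurable]: "f \<in> borel_measurable borel"
    and "integrable \<nu> (\<lambda>x. f x * exp (\<theta> * x))"
  shows "integrable (nef_member \<nu> \<theta>) f"
proof -
  have "integrable \<nu> (\<lambda>x. exp (\<theta> * x - cumulant \<nu> \<theta>) *\<^sub>R f x)"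
    using moment_0_pos[OF assms(1)] assms(3) by (simp add: cumulant_eq assms(1) exp_diff mult.commute)
  then show ?thesis unfolding nef_member_def by (subst integrable_density) auto
qed

lemma variance_function_mean:
  assumes "\<theta> \<in> Theta \<nu>"
  shows "variance_function \<nu> (mean \<nu> \<theta>) = var \<nu> \<theta>"
proof -
  have "inj_on (deriv (cumulant \<nu>)) (Theta \<nu>)"
    using inj_on_mean deriv_cumulant by (simp add: inj_on_def)
  then have "psi \<nu> (mean \<nu> \<theta>) = \<theta>"
    unfolding psi_def using the_inv_into_f_f[of "deriv (cumulant \<nu>)" "Theta \<nu>" \<theta>] assms deriv_cumulant
    by simp
  then have "variance_function \<nu> (mean \<nu> \<theta>) = (\<integral>x. (x - mean \<nu> \<theta>)\<^sup>2 * exp (\<theta> * x) \<partial>\<nu>) / moment \<nu> 0 \<theta>"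
    unfolding variance_function_def member_of_mean_def
    using integral_nef_member[OF assms, of "\<lambda>x. (x - mean \<nu> \<theta>)\<^sup>2"] by simp
  also have "\<dots> = var \<nu> \<theta>"
    using moment_0_pos[OF assms] unfolding integral_square_Theta[OF assms] var_def mean_def
    by (simp add: field_simps power2_eq_square)
  finally show ?thesis .
qed

lemma cubic_nef_iff:
  "cubic_nef \<nu> \<longleftrightarrow> (\<exists>p. degree p \<le> 3 \<and> (\<forall>\<theta>\<in>Theta \<nu>. var \<nu> \<theta> = poly p (mean \<nu> \<theta>)))"
  unfolding cubic_nef_def mean_domain_def
  by (simp add: deriv_cumulant variance_function_mean cong: image_cong)

section \<open>Exponential 2-orthogonal polynomials force a cubic variance function\<close>

text \<open>
  \<open>exp (a(z) x + b(z))\<close> is, up to a factor independent of \<open>x\<close>, the density of the member with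
  parameter \<open>\<theta> + a(z)\<close> with respect to the one with parameter \<open>\<theta>\<close>. Hence pairing the generating
  function with \<open>p\<close> yields the integral of \<open>p\<close> under the tilted measure.
\<close>

lemma exponential_gf_moments:
  assumes \<theta>: "\<theta> \<in> Theta \<nu>" and r: "r > 0" "real_analytic_on a {-r<..<r}" "real_analytic_on b {-r<..<r}"
    and gf: "\<And>z x. z \<in> {-r<..<r} \<Longrightarrow> (\<lambda>n. poly (Q n) x * (z ^ n / fact n)) sums exp (a z * x + b z)"
    and a0: "a 0 = 0"
  shows "\<exists>\<rho>>0. \<rho> \<le> r \<and> (\<forall>z. \<bar>z\<bar> < \<rho> \<longrightarrow> \<theta> + a z \<in> Theta \<nu> \<and>
    (\<forall>p. (\<lambda>n. (\<integral>x. poly (Q n) x * poly p x \<partial>nef_member \<nu> \<theta>) / fact n * z ^ n)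
        sums (exp (b z) / moment \<nu> 0 \<theta> * (\<Sum>i\<le>degree p. coeff p i * moment \<nu> i (\<theta> + a z)))))"
proof -
  obtain \<delta> where \<delta>: "\<delta> > 0" "{\<theta> - \<delta>..\<theta> + \<delta>} \<subseteq> Theta \<nu>" "integrable \<nu> (\<lambda>x. exp (\<delta> * \<bar>x\<bar> + \<theta> * x))"
    using integrable_exp_abs_Theta[OF \<theta>] by blast
  have int: "integrable (nef_member \<nu> \<theta>) (\<lambda>x. exp (\<delta> * \<bar>x\<bar>))"
    by (rule integrable_nef_member[OF \<theta>]) (use \<delta> in \<open>auto simp: exp_add\<close>)
  have sets: "sets (nef_member \<nu> \<theta>) = sets borel"
    by (simp add: nef_member_def sets_nu)
  obtain \<rho> where \<rho>: "0 < \<rho>" "\<rho> \<le> r" "\<And>z. \<bar>z\<bar> < \<rho> \<Longrightarrow> \<bar>a z\<bar> < \<delta>"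
    "\<And>z p. \<bar>z\<bar> < \<rho> \<Longrightarrow> (\<lambda>n. (\<integral>x. poly (Q n) x * poly p x \<partial>nef_member \<nu> \<theta>) / fact n * z ^ n)
        sums (\<integral>x. exp (a z * x + b z) * poly p x \<partial>nef_member \<nu> \<theta>)"
    using exponential_gf_integral[OF r gf a0 sets \<delta>(1) int] by blast
  show ?thesis
  proof (intro exI[of _ \<rho>] conjI allI impI)
    show "0 < \<rho>" "\<rho> \<le> r" using \<rho> by auto
    fix z assume z: "\<bar>z\<bar> < \<rho>"
    then show az: "\<theta> + a z \<in> Theta \<nu>" using \<rho>(3)[OF z] by (intro subsetD[OF \<delta>(2)]) auto
    fix p
    have "(\<integral>x. exp (a z * x + b z) * poly p x \<partial>nef_member \<nu> \<theta>)
        = (\<integral>x. exp (b z) * (poly p x * exp ((\<theta> + a z) * x)) \<partial>\<nu>) / moment \<nu> 0 \<theta>"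
      by (subst integral_nef_member[OF \<theta>])
        (auto simp: exp_add algebra_simps intro!: arg_cong2[where f = "(/)"] Bochner_Integration.integral_cong)
    also have "\<dots> = exp (b z) / moment \<nu> 0 \<theta> * (\<Sum>i\<le>degree p. coeff p i * moment \<nu> i (\<theta> + a z))"
      using integral_poly_exp_Theta[OF az] by simp
    finally show "(\<lambda>n. (\<integral>x. poly (Q n) x * poly p x \<partial>nef_member \<nu> \<theta>) / fact n * z ^ n)
        sums (exp (b z) / moment \<nu> 0 \<theta> * (\<Sum>i\<le>degree p. coeff p i * moment \<nu> i (\<theta> + a z)))"
      using \<rho>(4)[OF z, of p] by simp
  qed
qed

text \<open>
  The mean and the variance are quotients with denominator a power of \<open>moment \<nu> 0\<close>. Clearing
  denominators turns the claimed relation into the vanishing of a polynomial \<open>H\<close> in the first three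
  moment functions, which is holomorphic on a connected strip, so that the identity theorem applies.
  The complex Laplace transform may have zeros, but \<open>H\<close> does not divide by it.
\<close>

lemma var_eq_poly_mean_extends:
  assumes U: "U \<subseteq> Theta \<nu>" "\<theta>\<^sub>0 \<in> Theta \<nu>" "\<theta>\<^sub>0 islimpt U"
    and eq: "\<And>\<theta>. \<theta> \<in> U \<Longrightarrow> var \<nu> \<theta> = poly p (mean \<nu> \<theta>)"
    and \<theta>: "\<theta> \<in> Theta \<nu>"
  shows "var \<nu> \<theta> = poly p (mean \<nu> \<theta>)"
proof -
  define d where "d = degree p"
  define H where "H z = cmoment \<nu> 2 z * cmoment \<nu> 0 z ^ (d + 1) - cmoment \<nu> 1 z ^ 2 * cmoment \<nu> 0 z ^ d
     - (\<Sum>i\<le>d. of_real (coeff p i) * cmoment \<nu> 1 z ^ i * cmoment \<nu> 0 z ^ (d + 2 - i))" for z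
  have H_real: "H (of_real t) = of_real (moment \<nu> 0 t ^ (d + 2) * (var \<nu> t - poly p (mean \<nu> t)))"
    if "t \<in> Theta \<nu>" for t
  proof -
    have M: "moment \<nu> 0 t > 0" using moment_0_pos that by blast
    have "moment \<nu> 0 t ^ (d + 2) * poly p (mean \<nu> t)
        = (\<Sum>i\<le>d. coeff p i * moment \<nu> 1 t ^ i * moment \<nu> 0 t ^ (d + 2 - i))"
      unfolding poly_altdef d_def[symmetric] sum_distrib_left
      using M by (intro sum.cong) (auto simp: mean_def power_divide power_diff)
    moreover have "moment \<nu> 0 t ^ (d + 2) * var \<nu> t
        = moment \<nu> 2 t * moment \<nu> 0 t ^ (d + 1) - moment \<nu> 1 t ^ 2 * moment \<nu> 0 t ^ d"
      using M by (simp add: var_def mean_def field_simps power2_eq_square)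
    ultimately show ?thesis
      by (simp only: H_def cmoment_of_real right_diff_distrib of_real_diff of_real_mult of_real_sum of_real_power)
  qed
  let ?S = "{z. Re z \<in> Theta \<nu>}"
  have "H (of_real \<theta>) = 0"
  proof (rule analytic_continuation[where f = H and w = "of_real \<theta>" and S = ?S and U = "complex_of_real ` U" and \<xi> = "of_real \<theta>\<^sub>0"])
    have S: "?S = Re -` Theta \<nu>" by auto
    show "open ?S" unfolding S by (intro open_vimage open_Theta continuous_intros)
    have "convex ?S"
      using convex_Theta unfolding convex_alt by auto
    then show "connected ?S" by (rule convex_connected)
    have "cmoment \<nu> j holomorphic_on ?S" for j
      by (rule holomorphic_onI) (use DERIV_cmoment in \<open>auto simp: field_differentiable_def
          intro: has_field_derivative_at_within\<close>)
    then show "H holomorphic_on ?S" unfolding H_def by (intro holomorphic_intros)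
    show "complex_of_real \<theta>\<^sub>0 islimpt complex_of_real ` U"
      using U(3) by (force simp: islimpt_approachable dist_of_real)
    show "H z = 0" if "z \<in> complex_of_real ` U" for z
      using that H_real U(1) eq by auto
  qed (use U \<theta> in auto)
  then show ?thesis using H_real[OF \<theta>] moment_0_pos[OF \<theta>] by simp
qed

end

lemma power_series_eventually_zero:
  fixes c :: "nat \<Rightarrow> real"
  assumes "N > 0" "\<And>n. n \<ge> N \<Longrightarrow> c n = 0"
  obtains w where "degree w < N" "\<And>z. (\<lambda>n. c n * z ^ n) sums poly w z"
proof -
  define w where "w = (\<Sum>n<N. monom (c n) n)"
  have "degree w < N"
    unfolding w_def
    by (rule degree_sum_less) (auto intro: le_less_trans[OF degree_monom_le] assms)
  moreover have "(\<lambda>n. c n * z ^ n) sums poly w z" for z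
    using sums_finite[of "{..<N}" "\<lambda>n. c n * z ^ n"] assms(2)
    by (simp add: w_def poly_sum poly_monom not_less)
  ultimately show ?thesis using that by blast
qed

lemma real_analytic_tendsto_0:
  assumes "real_analytic_on f {-r<..<r}" "r > 0" "f 0 = 0"
  shows "(f \<longlongrightarrow> 0) (at 0)"
proof -
  have "0 \<in> {-r<..<r}" using assms by simp
  from bspec[OF assms(1)[unfolded real_analytic_on_def] this]
  obtain \<epsilon> c where *: "\<epsilon> > 0" "\<And>x. \<bar>x\<bar> < \<epsilon> \<Longrightarrow> (\<lambda>n. c n * x ^ n) sums f x" by auto
  have "(f \<longlongrightarrow> c 0) (at 0)" by (rule powser_limit_0[of \<epsilon>]) (use * in auto)
  moreover have "c 0 = 0" using *(2)[of 0] * assms(3) by (simp add: powser_sums_zero_iff)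
  ultimately show ?thesis by simp
qed

context nef_generator
begin

text \<open>
  Pair the generating function with \<open>Q\<^sub>0\<close>, \<open>Q\<^sub>1\<close> and \<open>Q\<^sub>2\<close>. By 2-orthogonality these pairings are
  polynomials in \<open>z\<close> of degrees at most \<open>0\<close>, \<open>1\<close> and \<open>3\<close>. The first says that
  \<open>exp (a(z) x + b(z))\<close> has constant mass, so the others give, up to a factor, the expectations of
  \<open>Q\<^sub>1\<close> and \<open>Q\<^sub>2\<close> under the member with parameter \<open>\<theta>\<^sub>0 + a(z)\<close>. As \<open>Q\<^sub>1\<close> has degree exactly \<open>1\<close> and
  \<open>Q\<^sub>2\<close> degree exactly \<open>2\<close>, the mean of this member is an affine function of \<open>z\<close> and its variance
  a cubic one. The affine function is not constant, so \<open>z\<close> can be eliminated.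
\<close>

lemma cubic_if_two_orthogonal_exponential:
  assumes \<theta>0: "\<theta>\<^sub>0 \<in> Theta \<nu>" and orth: "two_orthogonal (nef_member \<nu> \<theta>\<^sub>0) Q" and gfQ: "exponential_gf Q"
  shows "cubic_nef \<nu>"
proof -
  let ?\<mu> = "nef_member \<nu> \<theta>\<^sub>0"
  have deg: "degree (Q n) = n" for n
    using orth by (simp add: two_orthogonal_def polynomial_family_def)
  have orthQ: "(\<integral>x. poly (Q n) x * poly (Q q) x \<partial>?\<mu>) = 0" if "q \<ge> 1" "2 * q \<le> n" for n q
    using orth that unfolding two_orthogonal_def by simp
  have orth1: "(\<integral>x. poly (Q n) x \<partial>?\<mu>) = 0" if "n \<ge> 1" for n
    using orth that unfolding two_orthogonal_def by simp
  obtain r a b where r: "r > 0" "real_analytic_on a {-r<..<r}" "real_analytic_on b {-r<..<r}"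
    and gf: "\<And>z x. z \<in> {-r<..<r} \<Longrightarrow> (\<lambda>n. poly (Q n) x * (z ^ n / fact n)) sums exp (a z * x + b z)"
    using gfQ unfolding exponential_gf_def by blast
  have "poly (Q 0) x = exp (a 0 * x + b 0)" for x
    using gf[of 0 x] r(1) powser_sums_zero_iff[of "\<lambda>n. poly (Q n) x / fact n"] by simp
  moreover have "poly (Q 0) 0 = poly (Q 0) 1" using deg[of 0] by (auto elim!: degree_eq_zeroE)
  ultimately have a0: "a 0 = 0" by simp
  obtain \<rho> where \<rho>: "0 < \<rho>" "\<rho> \<le> r" and Th: "\<And>z. \<bar>z\<bar> < \<rho> \<Longrightarrow> \<theta>\<^sub>0 + a z \<in> Theta \<nu>"
    and S: "\<And>z p. \<bar>z\<bar> < \<rho> \<Longrightarrow> (\<lambda>n. (\<integral>x. poly (Q n) x * poly p x \<partial>?\<mu>) / fact n * z ^ n)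
        sums (exp (b z) / moment \<nu> 0 \<theta>\<^sub>0 * (\<Sum>i\<le>degree p. coeff p i * moment \<nu> i (\<theta>\<^sub>0 + a z)))"
    using exponential_gf_moments[OF \<theta>0 r gf a0] by blast
  define R where "R i z = moment \<nu> i (\<theta>\<^sub>0 + a z) / moment \<nu> 0 (\<theta>\<^sub>0 + a z)" for i z
  have R1: "R 1 z = mean \<nu> (\<theta>\<^sub>0 + a z)" for z by (simp add: R_def mean_def)
  define c where "c = (\<integral>x. poly (Q 0) x \<partial>?\<mu>)"
  have c: "exp (b z) / moment \<nu> 0 \<theta>\<^sub>0 * moment \<nu> 0 (\<theta>\<^sub>0 + a z) = c" if "\<bar>z\<bar> < \<rho>" for z
  proof -
    have "(\<lambda>n. (\<integral>x. poly (Q n) x \<partial>?\<mu>) / fact n * z ^ n) sums c"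
      using sums_finite[of "{0}" "\<lambda>n. (\<integral>x. poly (Q n) x \<partial>?\<mu>) / fact n * z ^ n"] orth1
      by (simp add: c_def)
    then show ?thesis using S[OF that, of 1] by (simp add: sums_iff)
  qed
  have "c > 0" using c[of 0] \<rho>(1) a0 moment_0_pos[OF \<theta>0] exp_gt_zero[of "b 0"] by simp
  \<comment> \<open>Dividing by the constant mass turns the pairing with \<open>Q\<^sub>q\<close> into an expectation under a probability measure.\<close>
  have "\<exists>w. degree w < 2 * q \<and> (\<forall>z. \<bar>z\<bar> < \<rho> \<longrightarrow> (\<Sum>i\<le>q. coeff (Q q) i * R i z) = poly w z)"
    if q: "q \<ge> 1" for q
  proof -
    obtain w where w: "degree w < 2 * q"
      "\<And>z. (\<lambda>n. (\<integral>x. poly (Q n) x * poly (Q q) x \<partial>?\<mu>) / fact n * z ^ n) sums poly w z"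
      using power_series_eventually_zero[of "2 * q" "\<lambda>n. (\<integral>x. poly (Q n) x * poly (Q q) x \<partial>?\<mu>) / fact n"]
        orthQ[OF q] q by auto
    have "(\<Sum>i\<le>q. coeff (Q q) i * R i z) = poly (smult (1 / c) w) z" if z: "\<bar>z\<bar> < \<rho>" for z
    proof -
      have M: "moment \<nu> 0 (\<theta>\<^sub>0 + a z) > 0" using moment_0_pos Th z by blast
      have "poly w z = exp (b z) / moment \<nu> 0 \<theta>\<^sub>0 * (\<Sum>i\<le>q. coeff (Q q) i * moment \<nu> i (\<theta>\<^sub>0 + a z))"
        using S[OF z, of "Q q"] w(2)[of z] deg by (simp add: sums_iff)
      also have "\<dots> = c * (\<Sum>i\<le>q. coeff (Q q) i * R i z)"
        unfolding c[OF z, symmetric] sum_distrib_left using M by (intro sum.cong) (auto simp: R_def)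
      finally show ?thesis using \<open>c > 0\<close> by simp
    qed
    then show ?thesis using w(1) by (intro exI[of _ "smult (1 / c) w"]) auto
  qed
  from this[of 1] this[of 2] obtain w1 w2 where w1: "degree w1 < 2"
      "\<And>z. \<bar>z\<bar> < \<rho> \<Longrightarrow> coeff (Q 1) 0 * R 0 z + coeff (Q 1) 1 * R 1 z = poly w1 z"
    and w2: "degree w2 < 4"
      "\<And>z. \<bar>z\<bar> < \<rho> \<Longrightarrow> coeff (Q 2) 0 * R 0 z + coeff (Q 2) 1 * R 1 z + coeff (Q 2) 2 * R 2 z = poly w2 z"
    by (auto simp: eval_nat_numeral)
  have R0: "R 0 z = 1" if "\<bar>z\<bar> < \<rho>" for z
    using moment_0_pos[OF Th[OF that]] by (simp add: R_def)
  have lead: "coeff (Q 1) 1 \<noteq> 0" "coeff (Q 2) 2 \<noteq> 0"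
    using deg[of 1] deg[of 2] leading_coeff_0_iff[of "Q 1"] leading_coeff_0_iff[of "Q 2"] by auto
  define u where "u = smult (1 / coeff (Q 1) 1) (w1 - [:coeff (Q 1) 0:])"
  have u: "mean \<nu> (\<theta>\<^sub>0 + a z) = poly u z" if "\<bar>z\<bar> < \<rho>" for z
    using w1(2)[OF that] R0[OF that] lead unfolding R1[symmetric] u_def by (simp add: field_simps)
  define v where "v = smult (1 / coeff (Q 2) 2) (w2 - [:coeff (Q 2) 0:] - smult (coeff (Q 2) 1) u) - u * u"
  have v: "var \<nu> (\<theta>\<^sub>0 + a z) = poly v z" if "\<bar>z\<bar> < \<rho>" for z
  proof -
    have "R 2 z = poly (v + u * u) z"
      using w2(2)[OF that] R0[OF that] lead unfolding R1 u[OF that] v_def by (simp add: field_simps)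
    moreover have "var \<nu> (\<theta>\<^sub>0 + a z) = R 2 z - (poly u z)\<^sup>2"
      by (simp add: var_def R_def u[OF that])
    ultimately show ?thesis by (simp add: power2_eq_square)
  qed
  have degu: "degree u \<le> 1"
    unfolding u_def using w1(1) by (intro order_trans[OF degree_smult_le] degree_diff_le) auto
  have degv: "degree v \<le> 3"
  proof -
    have "degree (u * u) \<le> 3" using degree_mult_le[of u u] degu by linarith
    moreover have "degree (smult (coeff (Q 2) 1) u) \<le> 3"
      using degree_smult_le[of "coeff (Q 2) 1" u] degu by linarith
    ultimately show ?thesis
      unfolding v_def using w2(1) degu by (intro degree_diff_le order_trans[OF degree_smult_le]) auto
  qed
  define u0 where "u0 = coeff u 0"
  define u1 where "u1 = coeff u 1"
  have uu: "u = [:u0, u1:]"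
    using degu by (intro poly_eqI) (auto simp: u0_def u1_def coeff_pCons coeff_eq_0 split: nat.split)
  \<comment> \<open>With a constant mean, \<open>a\<close> would vanish and the generating function would not depend on \<open>x\<close>, contradicting \<open>deg Q\<^sub>1 = 1\<close>.\<close>
  have "u1 \<noteq> 0"
  proof
    assume "u1 = 0"
    have az: "a z = 0" if "\<bar>z\<bar> < \<rho>" for z
    proof -
      have "mean \<nu> (\<theta>\<^sub>0 + a z) = mean \<nu> \<theta>\<^sub>0"
        using u[OF that] u[of 0] \<rho>(1) a0 by (simp add: uu \<open>u1 = 0\<close>)
      then show ?thesis using inj_on_mean Th[OF that] \<theta>0 by (auto dest: inj_onD)
    qed
    have "(\<lambda>n. poly (Q n) 0 / fact n) = (\<lambda>n. poly (Q n) 1 / fact n)"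
    proof (rule real_power_series_unique[OF \<rho>(1)])
      fix z :: real assume z: "\<bar>z\<bar> < \<rho>"
      have "z \<in> {-r<..<r}" using z \<rho> by auto
      then show "(\<lambda>n. poly (Q n) 0 / fact n * z ^ n) sums exp (b z)"
        "(\<lambda>n. poly (Q n) 1 / fact n * z ^ n) sums exp (b z)"
        using gf[of z 0] gf[of z 1] az[OF z] by simp_all
    qed
    then have "poly (Q 1) 0 = poly (Q 1) 1" by (auto dest: fun_cong[where x = 1])
    then show False using lead(1) deg[of 1] by (simp add: poly_altdef)
  qed
  \<comment> \<open>The cubic in \<open>z\<close>, rewritten in terms of the mean \<open>u\<^sub>0 + u\<^sub>1 z\<close>.\<close>
  define p where "p = pcompose v [:- u0 / u1, 1 / u1:]"
  have "degree p \<le> 3"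
    using degv degree_pcompose_le[of v "[:- u0 / u1, 1 / u1:]"] unfolding p_def by (simp add: \<open>u1 \<noteq> 0\<close>)
  moreover have "var \<nu> \<theta> = poly p (mean \<nu> \<theta>)" if "\<theta> \<in> Theta \<nu>" for \<theta>
  proof (rule var_eq_poly_mean_extends[OF _ \<theta>0 _ _ that])
    let ?U = "(\<lambda>z. \<theta>\<^sub>0 + a z) ` {-\<rho><..<\<rho>}"
    show "?U \<subseteq> Theta \<nu>" using Th by (auto simp: abs_less_iff)
    show "var \<nu> \<theta>' = poly p (mean \<nu> \<theta>')" if \<theta>': "\<theta>' \<in> ?U" for \<theta>'
    proof -
      from \<theta>' obtain z where "z \<in> {-\<rho><..<\<rho>}" "\<theta>' = \<theta>\<^sub>0 + a z" by blast
      then have z: "\<bar>z\<bar> < \<rho>" "\<theta>' = \<theta>\<^sub>0 + a z" by auto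
      then show ?thesis using u[OF z(1)] v[OF z(1)] \<open>u1 \<noteq> 0\<close>
        by (simp add: p_def poly_pcompose uu field_simps)
    qed
    \<comment> \<open>The mean, hence \<open>a\<close>, is injective in \<open>z\<close>, so \<open>a(z)\<close> tends to \<open>0\<close> through nonzero values.\<close>
    show "\<theta>\<^sub>0 islimpt ?U"
      unfolding islimpt_approachable
    proof (intro allI impI)
      fix e :: real assume "e > 0"
      have "\<forall>\<^sub>F z in at 0. dist (a z) 0 < e"
        using real_analytic_tendsto_0[OF r(2,1) a0] \<open>e > 0\<close> by (rule tendstoD)
      then obtain d where d: "d > 0" "\<And>z. z \<noteq> 0 \<Longrightarrow> \<bar>z\<bar> < d \<Longrightarrow> \<bar>a z\<bar> < e"
        by (auto simp: eventually_at)
      define z where "z = min d \<rho> / 2"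
      have z: "z \<noteq> 0" "\<bar>z\<bar> < d" "\<bar>z\<bar> < \<rho>" using d(1) \<rho>(1) by (auto simp: z_def)
      have "mean \<nu> (\<theta>\<^sub>0 + a z) \<noteq> mean \<nu> \<theta>\<^sub>0"
        using u[OF z(3)] u[of 0] \<rho>(1) a0 z(1) \<open>u1 \<noteq> 0\<close> by (simp add: uu)
      then have "a z \<noteq> 0" by auto
      moreover have "\<theta>\<^sub>0 + a z \<in> ?U" using z(3) by (intro image_eqI[where x = z]) auto
      ultimately show "\<exists>x'\<in>?U. x' \<noteq> \<theta>\<^sub>0 \<and> dist x' \<theta>\<^sub>0 < e"
        using d(2)[OF z(1,2)] by (intro bexI[of _ "\<theta>\<^sub>0 + a z"]) (auto simp: dist_norm)
    qed
  qed
  ultimately show ?thesis unfolding cubic_nef_iff by blast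
qed

end

section \<open>Moments in a cubic family\<close>

context nef_generator
begin

text \<open>
  If the variance is the polynomial \<open>p\<close> in the mean \<open>m\<close>, the recurrence for the moments becomes
  \<open>E\<^sub>j\<^sub>+\<^sub>1 = m E\<^sub>j + p dE\<^sub>j/dm\<close>. With \<open>p\<close> of degree at most \<open>3\<close> each step raises the degree
  by at most \<open>2\<close>, except the step from \<open>E\<^sub>0 = 1\<close> to \<open>E\<^sub>1 = m\<close>, which raises it by \<open>1\<close>. This is where
  the bound \<open>2j - 1\<close>, and with it the condition \<open>n \<ge> 2q\<close> of 2-orthogonality, comes from.
  For \<open>j = 0\<close> the truncated subtraction gives the correct bound \<open>0\<close>.
\<close>

lemma moment_ratio_eq_poly_mean:
  assumes p: "degree p \<le> 3" "\<And>\<theta>. \<theta> \<in> Theta \<nu> \<Longrightarrow> var \<nu> \<theta> = poly p (mean \<nu> \<theta>)"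
  shows "\<exists>q. degree q \<le> 2 * j - 1 \<and> (\<forall>\<theta>\<in>Theta \<nu>. moment \<nu> j \<theta> / moment \<nu> 0 \<theta> = poly q (mean \<nu> \<theta>))"
proof (induction j)
  case 0
  show ?case using moment_0_pos by (intro exI[of _ 1]) force
next
  case (Suc j)
  then obtain q where q: "degree q \<le> 2 * j - 1"
    "\<And>\<theta>. \<theta> \<in> Theta \<nu> \<Longrightarrow> moment \<nu> j \<theta> / moment \<nu> 0 \<theta> = poly q (mean \<nu> \<theta>)" by blast
  let ?q = "[:0, 1:] * q + pderiv q * p"
  have "moment \<nu> (Suc j) \<theta> / moment \<nu> 0 \<theta> = poly ?q (mean \<nu> \<theta>)" if \<theta>: "\<theta> \<in> Theta \<nu>" for \<theta>
  proof -
    have "((\<lambda>\<theta>. poly q (mean \<nu> \<theta>)) has_real_derivative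
        moment \<nu> (Suc j) \<theta> / moment \<nu> 0 \<theta> - moment \<nu> j \<theta> / moment \<nu> 0 \<theta> * mean \<nu> \<theta>) (at \<theta>)"
      by (rule has_field_derivative_transform_within_open[OF DERIV_moment_ratio[OF \<theta>] open_Theta \<theta>])
        (use q(2) in auto)
    moreover have "((\<lambda>\<theta>. poly q (mean \<nu> \<theta>)) has_real_derivative poly (pderiv q) (mean \<nu> \<theta>) * var \<nu> \<theta>) (at \<theta>)"
      by (rule DERIV_chain2[OF poly_DERIV DERIV_mean[OF \<theta>]])
    ultimately show ?thesis
      using DERIV_unique q(2)[OF \<theta>] p(2)[OF \<theta>] by (fastforce simp: algebra_simps)
  qed
  moreover have "degree ?q \<le> 2 * Suc j - 1"
  proof (rule degree_add_le)
    show "degree ([:0, 1:] * q) \<le> 2 * Suc j - 1"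
      using degree_mult_le[of "[:0, 1:]" q] q(1) by (cases j) (auto simp: degree_pCons_eq_if)
    show "degree (pderiv q * p) \<le> 2 * Suc j - 1"
    proof (cases "degree q = 0")
      case True
      then show ?thesis by (simp add: pderiv_eq_0_iff[THEN iffD2])
    next
      case False
      then show ?thesis using degree_mult_le[of "pderiv q" p] p(1) q(1) by (simp add: degree_pderiv)
    qed
  qed
  ultimately show ?case by blast
qed

end

section \<open>Polynomials with a prescribed exponential generating function\<close>

text \<open>
  \<open>h = exp (A x + B)\<close> satisfies \<open>h' = (A' x + B') h\<close>. On Taylor coefficients this is a recurrence
  that expresses the coefficient of index \<open>n + 1\<close> through earlier ones multiplied by affine functions
  of \<open>x\<close>; the coefficient of index \<open>n\<close> is multiplied by \<open>A'(0) x + B'(0)\<close>, which determines the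
  leading term.
\<close>

lemma taylor_coeffs_exp_affine:
  fixes A B :: "complex \<Rightarrow> complex"
  assumes A: "A analytic_on {0}" "A 0 = 0" and B: "B analytic_on {0}" "B 0 = 0"
  shows "\<exists>C. degree C \<le> n \<and> coeff C n = deriv A 0 ^ n / fact n \<and>
    (\<forall>x. (deriv ^^ n) (\<lambda>z. exp (A z * x + B z)) 0 / fact n = poly C x)"
proof -
  define h where "h x = (\<lambda>z. exp (A z * x + B z))" for x
  define H where "H x = fps_expansion (h x) 0" for x
  define FA where "FA = fps_expansion (deriv A) 0"
  define FB where "FB = fps_expansion (deriv B) 0"
  have hH: "h x has_fps_expansion H x" for x
    unfolding H_def h_def by (intro analytic_at_imp_has_fps_expansion_0 analytic_intros A B)
  have FA: "deriv A has_fps_expansion FA" and FB: "deriv B has_fps_expansion FB"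
    unfolding FA_def FB_def by (intro analytic_at_imp_has_fps_expansion_0 analytic_deriv A B)+
  have ode: "fps_deriv (H x) = (FA * fps_const x + FB) * H x" for x
  proof (rule fps_expansion_unique_complex)
    show "deriv (h x) has_fps_expansion fps_deriv (H x)" by (intro fps_expansion_intros hH)
    have ev: "\<forall>\<^sub>F z in nhds 0. f field_differentiable at z" if f: "f analytic_on {0}" for f :: "complex \<Rightarrow> complex"
    proof -
      obtain S where "open S" "0 \<in> S" "f holomorphic_on S" using f unfolding analytic_at by blast
      then show ?thesis
        by (auto simp: eventually_nhds intro!: exI[of _ S] holomorphic_on_imp_differentiable_at)
    qed
    have "\<forall>\<^sub>F z in nhds 0. A field_differentiable at z \<and> B field_differentiable at z"
      using A(1) B(1) by (intro eventually_conj ev)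
    then have "\<forall>\<^sub>F z in nhds 0. deriv (h x) z = (deriv A z * x + deriv B z) * h x z"
    proof eventually_elim
      case (elim z)
      then have "(A has_field_derivative deriv A z) (at z)" "(B has_field_derivative deriv B z) (at z)"
        by (auto simp: field_differentiable_derivI)
      then have "(h x has_field_derivative (deriv A z * x + deriv B z) * h x z) (at z)"
        unfolding h_def by (auto intro!: derivative_eq_intros)
      then show ?case by (rule DERIV_imp_deriv)
    qed
    moreover have "(\<lambda>z. (deriv A z * x + deriv B z) * h x z) has_fps_expansion (FA * fps_const x + FB) * H x"
      by (intro fps_expansion_intros hH FA FB)
    ultimately show "deriv (h x) has_fps_expansion (FA * fps_const x + FB) * H x"
      by (subst has_fps_expansion_cong[OF _ refl])
  qed
  have rec: "H x $ Suc n = (\<Sum>i\<le>n. (FA $ i * x + FB $ i) * H x $ (n - i)) / of_nat (Suc n)" for x n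
  proof -
    have "of_nat (Suc n) * H x $ Suc n = (\<Sum>i\<le>n. (FA $ i * x + FB $ i) * H x $ (n - i))"
      using arg_cong[OF ode[of x], of "\<lambda>F. F $ n"]
      by (simp add: fps_mult_nth[of _ "H x"] atLeast0AtMost)
    then show ?thesis by (simp add: field_simps del: of_nat_Suc)
  qed
  have H0: "H x $ 0 = 1" for x
    using fps_nth_fps_expansion[OF hH, of x 0] by (simp add: h_def A B)
  have FA0: "FA $ 0 = deriv A 0"
    using fps_nth_fps_expansion[OF FA, of 0] by simp
  have "\<exists>C. degree C \<le> n \<and> coeff C n = deriv A 0 ^ n / fact n \<and> (\<forall>x. H x $ n = poly C x)"
  proof (induction n rule: less_induct)
    case (less n)
    show ?case
    proof (cases n)
      case 0
      then show ?thesis by (intro exI[of _ 1]) (simp add: H0)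
    next
      case (Suc m)
      have "\<forall>k\<in>{..m}. \<exists>C. degree C \<le> k \<and> coeff C k = deriv A 0 ^ k / fact k \<and> (\<forall>x. H x $ k = poly C x)"
        using less Suc by auto
      then obtain C where C: "\<And>k. k \<le> m \<Longrightarrow> degree (C k) \<le> k"
        "\<And>k. k \<le> m \<Longrightarrow> coeff (C k) k = deriv A 0 ^ k / fact k"
        "\<And>k x. k \<le> m \<Longrightarrow> H x $ k = poly (C k) x"
        unfolding bchoice_iff by auto
      define D where "D = (\<Sum>i\<le>m. [:FB $ i, FA $ i:] * C (m - i))"
      have "degree D \<le> n"
        unfolding D_def
      proof (rule degree_sum_le)
        fix i assume "i \<in> {..m}"
        then have "degree (C (m - i)) \<le> m" using C(1)[of "m - i"] by simp
        moreover have "degree [:FB $ i, FA $ i:] \<le> 1" by simp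
        ultimately show "degree ([:FB $ i, FA $ i:] * C (m - i)) \<le> n"
          using degree_mult_le[of "[:FB $ i, FA $ i:]" "C (m - i)"] Suc by linarith
      qed simp
      moreover have "coeff D n = deriv A 0 ^ n / fact m"
      proof -
        have coeff: "coeff ([:FB $ i, FA $ i:] * C (m - i)) n = (if i = 0 then deriv A 0 ^ n / fact m else 0)"
          if "i \<le> m" for i
        proof -
          have "coeff (C (m - i)) n = 0" using C(1)[of "m - i"] Suc by (intro coeff_eq_0) simp
          moreover have "coeff (C (m - i)) m = 0" if "i \<noteq> 0"
            using C(1)[of "m - i"] that \<open>i \<le> m\<close> by (intro coeff_eq_0) linarith
          ultimately show ?thesis using C(2)[of m] by (simp add: Suc FA0)
        qed
        have "coeff D n = (\<Sum>i\<le>m. if i = 0 then deriv A 0 ^ n / fact m else 0)"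
          unfolding D_def coeff_sum using coeff by (intro sum.cong) auto
        then show ?thesis by simp
      qed
      moreover have "H x $ n = poly D x / of_nat n" for x
        unfolding Suc rec D_def poly_sum using C(3) by (intro arg_cong2[where f = "(/)"] sum.cong) (auto simp: algebra_simps)
      ultimately show ?thesis
        by (intro exI[of _ "smult (1 / of_nat n) D"])
          (auto simp: Suc intro: order_trans[OF degree_smult_le])
    qed
  qed
  then show ?thesis
    using fps_nth_fps_expansion[OF hH] unfolding h_def by simp
qed

lemma poly_map_poly_Re: "poly (map_poly Re C) x = Re (poly C (of_real x))"
  by (induction C) (auto simp: map_poly_pCons)

lemma poly_map_poly_complex_of_real:
  "poly (map_poly complex_of_real p) (of_real x) = of_real (poly p x)"
  by (induction p) (auto simp: map_poly_pCons)

text \<open>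
  Since \<open>A\<close> and \<open>B\<close> are real on the real axis near \<open>0\<close>, taking real parts of the Taylor
  coefficients does not change the sum at real points; it does not lower the degree because
  the leading coefficient \<open>A'(0)\<^sup>n/n!\<close> is real and nonzero.
\<close>

lemma exponential_polynomial_family:
  fixes A B :: "complex \<Rightarrow> complex"
  assumes A: "A holomorphic_on ball 0 R" "A 0 = 0" and B: "B holomorphic_on ball 0 R" "B 0 = 0"
    and A': "deriv A 0 = of_real \<alpha>" "\<alpha> \<noteq> 0" and \<rho>: "0 < \<rho>" "\<rho> \<le> R"
    and real: "\<And>x. \<bar>x\<bar> < \<rho> \<Longrightarrow> A (of_real x) = of_real (a x)" "\<And>x. \<bar>x\<bar> < \<rho> \<Longrightarrow> B (of_real x) = of_real (b x)"
  obtains Q where "polynomial_family Q"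
    "\<And>z x. z \<in> {-\<rho><..<\<rho>} \<Longrightarrow> (\<lambda>n. poly (Q n) x * (z ^ n / fact n)) sums exp (a z * x + b z)"
proof -
  have an: "A analytic_on {0}" "B analytic_on {0}"
    using A(1) B(1) \<rho> by (auto simp: analytic_at intro!: exI[of _ "ball 0 R"])
  have "\<forall>n. \<exists>C. degree C \<le> n \<and> coeff C n = deriv A 0 ^ n / fact n \<and>
    (\<forall>x. (deriv ^^ n) (\<lambda>z. exp (A z * x + B z)) 0 / fact n = poly C x)"
    using taylor_coeffs_exp_affine[OF an(1) A(2) an(2) B(2)] by blast
  then obtain C where C: "\<And>n. degree (C n) \<le> n" "\<And>n. coeff (C n) n = deriv A 0 ^ n / fact n"
    "\<And>n x. (deriv ^^ n) (\<lambda>z. exp (A z * x + B z)) 0 / fact n = poly (C n) x"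
    by metis
  define Q where "Q n = smult (fact n) (map_poly Re (C n))" for n
  have "degree (Q n) = n" for n
  proof (rule antisym)
    have "degree (map_poly Re (C n)) \<le> degree (C n)"
      by (intro degree_le) (simp add: coeff_map_poly coeff_eq_0)
    then show "degree (Q n) \<le> n" using C(1)[of n] by (simp add: Q_def)
    have "coeff (C n) n = of_real (\<alpha> ^ n / fact n)" by (simp add: C(2) A')
    then have "coeff (Q n) n = fact n * Re (of_real (\<alpha> ^ n / fact n))"
      by (simp only: Q_def coeff_smult coeff_map_poly zero_complex.sel)
    then have "coeff (Q n) n = \<alpha> ^ n" by (simp only: Re_complex_of_real) simp
    then show "n \<le> degree (Q n)" using A'(2) by (intro le_degree) simp
  qed
  then have "polynomial_family Q" by (simp add: polynomial_family_def)
  moreover have "(\<lambda>n. poly (Q n) x * (z ^ n / fact n)) sums exp (a z * x + b z)"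
    if z: "z \<in> {-\<rho><..<\<rho>}" for z x
  proof -
    let ?h = "\<lambda>z. exp (A z * of_real x + B z)"
    have z': "\<bar>z\<bar> < \<rho>" using z by auto
    have "(\<lambda>n. (deriv ^^ n) ?h 0 / fact n * (of_real z - 0) ^ n) sums ?h (of_real z)"
      by (rule holomorphic_power_series[where r = R])
        (use z' \<rho> in \<open>auto intro!: holomorphic_intros A B\<close>)
    then have "(\<lambda>n. poly (C n) (of_real x) * of_real (z ^ n)) sums of_real (exp (a z * x + b z))"
      by (simp add: C(3) real[OF z'] flip: exp_of_real)
    from sums_Re[OF this] show ?thesis
      by (simp add: Q_def poly_map_poly_Re mult_ac)
  qed
  ultimately show ?thesis using that by blast
qed

section \<open>A cubic variance function yields 2-orthogonal polynomials\<close>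

context nef_generator
begin

text \<open>
  Parametrizing the family by \<open>z = m - m\<^sub>0\<close>, the difference between the mean and the mean \<open>m\<^sub>0\<close> of the given
  member, the canonical parameter has derivative \<open>1/p(m\<^sub>0 + z)\<close> and minus the cumulant function has
  derivative \<open>- (m\<^sub>0 + z)/p(m\<^sub>0 + z)\<close>. These are rational functions, so \<open>A\<close> and \<open>B\<close> are obtained as
  their primitives on a complex disc free of zeros of \<open>p(m\<^sub>0 + z)\<close>. They agree with the real
  quantities on the real axis since, as functions of \<open>\<theta>\<close>, the differences have derivative zero.
\<close>

lemma mean_parametrization:
  assumes p: "\<And>\<theta>. \<theta> \<in> Theta \<nu> \<Longrightarrow> var \<nu> \<theta> = poly p (mean \<nu> \<theta>)" and \<theta>0: "\<theta>\<^sub>0 \<in> Theta \<nu>"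
  obtains A :: "complex \<Rightarrow> complex" and R :: real and B :: "complex \<Rightarrow> complex" and \<rho> :: real where "A holomorphic_on ball 0 R" "A 0 = 0"
    "B holomorphic_on ball 0 R" "B 0 = 0" "deriv A 0 = of_real (1 / var \<nu> \<theta>\<^sub>0)" "0 < \<rho>" "\<rho> \<le> R"
    "\<And>z. \<bar>z\<bar> < \<rho> \<Longrightarrow> \<exists>\<theta>\<in>Theta \<nu>. mean \<nu> \<theta> = mean \<nu> \<theta>\<^sub>0 + z \<and> A (of_real z) = of_real (\<theta> - \<theta>\<^sub>0) \<and>
       B (of_real z) = of_real (ln (moment \<nu> 0 \<theta>\<^sub>0) - ln (moment \<nu> 0 \<theta>))"
proof -
  define m0 where "m0 = mean \<nu> \<theta>\<^sub>0"
  define D where "D z = poly (map_poly complex_of_real p) (of_real m0 + z)" for z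
  have D_real: "D (of_real y) = of_real (poly p (m0 + y))" for y
    unfolding D_def of_real_add[symmetric] by (rule poly_map_poly_complex_of_real)
  have "isCont D 0" unfolding D_def by (intro continuous_intros)
  moreover have D0: "D 0 = of_real (var \<nu> \<theta>\<^sub>0)" using D_real[of 0] p[OF \<theta>0] by (simp add: m0_def)
  then have "D 0 \<noteq> 0" using var_pos[OF \<theta>0] by simp
  ultimately obtain R where R: "R > 0" "\<And>z. dist z 0 < R \<Longrightarrow> D z \<noteq> 0"
    using continuous_at_avoid[of 0 D 0] by (auto simp: dist_commute)
  have D: "D z \<noteq> 0" if "z \<in> ball 0 R" for z using R(2)[of z] that by (simp add: dist_commute)
  have primitive: "\<exists>G. G 0 = 0 \<and> (\<forall>z\<in>ball 0 R. (G has_field_derivative g z / D z) (at z))"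
    if g: "g holomorphic_on ball 0 R" for g
  proof -
    have "(\<lambda>z. g z / D z) holomorphic_on ball 0 R"
      using D g unfolding D_def by (intro holomorphic_intros) auto
    then obtain G where G: "\<And>z. z \<in> ball 0 R \<Longrightarrow> (G has_field_derivative g z / D z) (at z within ball 0 R)"
      using holomorphic_convex_primitive'[of "ball 0 R" "\<lambda>z. g z / D z"] by auto
    then have "((\<lambda>z. G z - G 0) has_field_derivative g z / D z) (at z)" if "z \<in> ball 0 R" for z
      using that G[OF that] at_within_open[of z "ball 0 R"] by (auto intro!: derivative_eq_intros)
    then show ?thesis by (intro exI[of _ "\<lambda>z. G z - G 0"]) auto
  qed
  obtain A where A: "A 0 = 0" "\<And>z. z \<in> ball 0 R \<Longrightarrow> (A has_field_derivative 1 / D z) (at z)"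
    using primitive[of "\<lambda>_. 1"] by auto
  have "(\<lambda>z. - (of_real m0 + z)) holomorphic_on ball 0 R" by (intro holomorphic_intros)
  from primitive[OF this] obtain B where
    B: "B 0 = 0" "\<And>z. z \<in> ball 0 R \<Longrightarrow> (B has_field_derivative - (of_real m0 + z) / D z) (at z)"
    by blast
  have hol: "A holomorphic_on ball 0 R" "B holomorphic_on ball 0 R"
    using A(2) B(2) by (metis holomorphic_on_open open_ball)+
  have A': "deriv A 0 = of_real (1 / var \<nu> \<theta>\<^sub>0)"
    using A(2)[of 0] R(1) by (auto simp: D0 DERIV_imp_deriv)
  have cont: "isCont (mean \<nu>) \<theta>" if "\<theta> \<in> Theta \<nu>" for \<theta>
    using DERIV_mean[OF that] by (rule DERIV_isCont)
  have "\<forall>\<^sub>F \<theta> in nhds \<theta>\<^sub>0. \<bar>mean \<nu> \<theta> - m0\<bar> < R \<and> \<theta> \<in> Theta \<nu>"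
  proof (rule eventually_conj)
    have "(mean \<nu> \<longlongrightarrow> m0) (nhds \<theta>\<^sub>0)"
      using cont[OF \<theta>0] unfolding isCont_def m0_def tendsto_at_iff_tendsto_nhds .
    then show "\<forall>\<^sub>F \<theta> in nhds \<theta>\<^sub>0. \<bar>mean \<nu> \<theta> - m0\<bar> < R"
      using tendstoD R(1) by (fastforce simp: dist_norm)
    show "\<forall>\<^sub>F \<theta> in nhds \<theta>\<^sub>0. \<theta> \<in> Theta \<nu>"
      using open_Theta \<theta>0 by (rule eventually_nhds_in_open)
  qed
  then obtain \<delta> where \<delta>: "\<delta> > 0" "\<And>\<theta>. dist \<theta> \<theta>\<^sub>0 < \<delta> \<Longrightarrow> \<bar>mean \<nu> \<theta> - m0\<bar> < R \<and> \<theta> \<in> Theta \<nu>"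
    unfolding eventually_nhds_metric by blast
  define J where "J = ball \<theta>\<^sub>0 \<delta>"
  have J: "\<bar>mean \<nu> \<theta> - m0\<bar> < R" "\<theta> \<in> Theta \<nu>" if "\<theta> \<in> J" for \<theta>
    using \<delta>(2)[of \<theta>] that by (auto simp: J_def dist_commute)
  have chain: "((\<lambda>\<theta>. G (of_real (mean \<nu> \<theta> - m0))) has_vector_derivative of_real (var \<nu> \<theta>) * G') (at \<theta>)"
    if "\<theta> \<in> J" "\<And>z. z \<in> ball 0 R \<Longrightarrow> (G has_field_derivative g z) (at z)"
      "G' = g (of_real (mean \<nu> \<theta> - m0))" for G g :: "complex \<Rightarrow> complex" and G' \<theta>
  proof -
    have "((\<lambda>\<theta>. complex_of_real (mean \<nu> \<theta> - m0)) has_vector_derivative of_real (var \<nu> \<theta>)) (at \<theta>)"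
      by (rule has_vector_derivative_of_real)
        (auto intro!: derivative_eq_intros DERIV_mean J that(1))
    from field_vector_diff_chain_at[OF this, of G G'] that J(1)[OF that(1)]
    show ?thesis by (simp add: o_def flip: of_real_diff)
  qed
  have const: "f \<theta> = f \<theta>\<^sub>0" if "\<theta> \<in> J" "\<And>\<theta>. \<theta> \<in> J \<Longrightarrow> (f has_vector_derivative 0) (at \<theta>)"
    for f :: "real \<Rightarrow> complex" and \<theta>
  proof -
    have "\<exists>k. \<forall>\<theta>\<in>J. f \<theta> = k"
    proof (rule has_derivative_zero_constant)
      show "convex J" by (simp add: J_def)
      show "(f has_derivative (\<lambda>h. 0)) (at \<theta> within J)" if "\<theta> \<in> J" for \<theta>
        using \<open>\<And>\<theta>. \<theta> \<in> J \<Longrightarrow> (f has_vector_derivative 0) (at \<theta>)\<close>[OF that]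
        by (auto simp: has_vector_derivative_def intro: has_derivative_at_withinI)
    qed
    then obtain k where "\<And>\<theta>. \<theta> \<in> J \<Longrightarrow> f \<theta> = k" by blast
    then show ?thesis using that(1) \<delta>(1) by (simp add: J_def)
  qed
  have Dmean: "D (of_real (mean \<nu> \<theta> - m0)) = of_real (var \<nu> \<theta>)" if "\<theta> \<in> J" for \<theta>
    unfolding D_real using p J(2)[OF that] by simp
  have Amean: "A (of_real (mean \<nu> \<theta> - m0)) = of_real (\<theta> - \<theta>\<^sub>0)" if "\<theta> \<in> J" for \<theta>
  proof -
    have "((\<lambda>\<theta>. A (of_real (mean \<nu> \<theta> - m0)) - of_real \<theta>) has_vector_derivative 0) (at \<theta>)" if "\<theta> \<in> J" for \<theta>
    proof -
      have "1 / complex_of_real (var \<nu> \<theta>) = 1 / D (of_real (mean \<nu> \<theta> - m0))"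
        by (simp only: Dmean[OF that])
      note dA = chain[OF that A(2) this]
      have "((\<lambda>\<theta>. A (of_real (mean \<nu> \<theta> - m0)) - of_real \<theta>) has_vector_derivative
          of_real (var \<nu> \<theta>) * (1 / of_real (var \<nu> \<theta>)) - of_real 1) (at \<theta>)"
        by (intro has_vector_derivative_diff dA has_vector_derivative_of_real DERIV_ident)
      then show ?thesis using var_pos[OF J(2)[OF that]] by simp
    qed
    from const[OF that this] show ?thesis by (simp add: m0_def A(1) diff_eq_eq)
  qed
  have Bmean: "B (of_real (mean \<nu> \<theta> - m0)) = of_real (ln (moment \<nu> 0 \<theta>\<^sub>0) - ln (moment \<nu> 0 \<theta>))"
    if "\<theta> \<in> J" for \<theta>
  proof -
    have "((\<lambda>\<theta>. B (of_real (mean \<nu> \<theta> - m0)) + of_real (ln (moment \<nu> 0 \<theta>))) has_vector_derivative 0) (at \<theta>)"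
      if "\<theta> \<in> J" for \<theta>
    proof -
      have "- complex_of_real (mean \<nu> \<theta>) / of_real (var \<nu> \<theta>)
          = - (of_real m0 + of_real (mean \<nu> \<theta> - m0)) / D (of_real (mean \<nu> \<theta> - m0))"
        by (simp only: Dmean[OF that]) simp
      note dB = chain[OF that B(2) this]
      have "((\<lambda>\<theta>. B (of_real (mean \<nu> \<theta> - m0)) + of_real (ln (moment \<nu> 0 \<theta>))) has_vector_derivative
          of_real (var \<nu> \<theta>) * (- of_real (mean \<nu> \<theta>) / of_real (var \<nu> \<theta>)) + of_real (mean \<nu> \<theta>)) (at \<theta>)"
        by (intro has_vector_derivative_add dB has_vector_derivative_of_real DERIV_ln_moment J that)
      then show ?thesis using var_pos[OF J(2)[OF that]] by simp
    qed
    from const[OF that this] show ?thesis by (simp add: m0_def B(1) algebra_simps)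
  qed
  \<comment> \<open>By the intermediate value theorem every mean close to \<open>m\<^sub>0\<close> is attained in \<open>J\<close>.\<close>
  define l where "l = \<theta>\<^sub>0 - \<delta> / 2"
  define u where "u = \<theta>\<^sub>0 + \<delta> / 2"
  have lu: "{l..u} \<subseteq> J" "l < \<theta>\<^sub>0" "\<theta>\<^sub>0 < u"
    using \<delta>(1) by (auto simp: l_def u_def J_def dist_norm abs_if)
  have in_J: "l \<in> J" "u \<in> J" "\<theta>\<^sub>0 \<in> J" using lu by auto
  define \<rho> where "\<rho> = min (mean \<nu> u - m0) (m0 - mean \<nu> l)"
  have "mean \<nu> l < m0" "m0 < mean \<nu> u"
    unfolding m0_def using strict_mono_on_mean lu(2,3) in_J J(2) by (auto intro: strict_mono_onD)
  then have "\<rho> > 0" by (simp add: \<rho>_def)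
  have "\<rho> \<le> R" using J(1)[OF in_J(1)] J(1)[OF in_J(2)] by (simp add: \<rho>_def)
  have "\<exists>\<theta>\<in>Theta \<nu>. mean \<nu> \<theta> = mean \<nu> \<theta>\<^sub>0 + z \<and> A (of_real z) = of_real (\<theta> - \<theta>\<^sub>0) \<and>
       B (of_real z) = of_real (ln (moment \<nu> 0 \<theta>\<^sub>0) - ln (moment \<nu> 0 \<theta>))" if z: "\<bar>z\<bar> < \<rho>" for z
  proof -
    have "\<exists>\<theta>\<ge>l. \<theta> \<le> u \<and> mean \<nu> \<theta> = m0 + z"
      using z lu J(2) cont by (intro IVT) (auto simp: \<rho>_def)
    then obtain \<theta> where \<theta>: "\<theta> \<in> J" "mean \<nu> \<theta> = m0 + z" using lu(1) by auto
    then show ?thesis using Amean[OF \<theta>(1)] Bmean[OF \<theta>(1)] J(2)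
      by (intro bexI[of _ \<theta>]) (auto simp: m0_def)
  qed
  then show ?thesis using that hol A(1) B(1) A' \<open>\<rho> > 0\<close> \<open>\<rho> \<le> R\<close> by blast
qed

lemma has_all_moments_nef_member:
  assumes "\<theta> \<in> Theta \<nu>"
  shows "has_all_moments (nef_member \<nu> \<theta>)"
  unfolding has_all_moments_def
proof
  fix n :: nat
  have "integrable (nef_member \<nu> \<theta>) (\<lambda>x. x ^ n)"
    by (rule integrable_nef_member[OF assms]) (auto intro: integrable_power_exp_Theta assms)
  then show "(\<integral>\<^sup>+ x. ennreal (\<bar>x\<bar> ^ n) \<partial>nef_member \<nu> \<theta>) < \<infinity>"
    by (simp add: integrable_iff_bounded power_abs)
qed

text \<open>
  The polynomials are the Taylor coefficients in \<open>z\<close> of the density of the member with mean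
  \<open>m\<^sub>0 + z\<close> with respect to the given one. Pairing this density with \<open>g\<close> gives the expectation of \<open>g\<close>
  under that member, which for \<open>g\<close> of degree \<open>q \<ge> 1\<close> is a polynomial in \<open>z\<close> of degree at most
  \<open>2q - 1\<close>. Comparing coefficients, \<open>Q\<^sub>n\<close> is orthogonal to \<open>g\<close> whenever \<open>n \<ge> 2q\<close>, and to the
  constants for \<open>n \<ge> 1\<close>.
\<close>

lemma two_orthogonal_exponential_if_cubic:
  assumes cubic: "cubic_nef \<nu>" and \<theta>0: "\<theta>\<^sub>0 \<in> Theta \<nu>"
  shows "\<exists>Q. two_orthogonal (nef_member \<nu> \<theta>\<^sub>0) Q \<and> exponential_gf Q"
proof -
  let ?\<mu> = "nef_member \<nu> \<theta>\<^sub>0"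
  obtain p where p: "degree p \<le> 3" "\<And>\<theta>. \<theta> \<in> Theta \<nu> \<Longrightarrow> var \<nu> \<theta> = poly p (mean \<nu> \<theta>)"
    using cubic unfolding cubic_nef_iff by auto
  obtain A R B \<rho> where A: "A holomorphic_on ball 0 R" "A 0 = 0"
    and B: "B holomorphic_on ball 0 R" "B 0 = 0" and A': "deriv A 0 = of_real (1 / var \<nu> \<theta>\<^sub>0)"
    and \<rho>: "0 < \<rho>" "\<rho> \<le> R"
    and par: "\<And>z. \<bar>z\<bar> < \<rho> \<Longrightarrow> \<exists>\<theta>\<in>Theta \<nu>. mean \<nu> \<theta> = mean \<nu> \<theta>\<^sub>0 + z \<and> A (of_real z) = of_real (\<theta> - \<theta>\<^sub>0) \<and>
       B (of_real z) = of_real (ln (moment \<nu> 0 \<theta>\<^sub>0) - ln (moment \<nu> 0 \<theta>))"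
    using mean_parametrization[OF p(2) \<theta>0, of thesis] by metis
  define a where "a z = Re (A (of_real z))" for z
  define b where "b z = Re (B (of_real z))" for z
  have an: "real_analytic_on a {-\<rho><..<\<rho>}" "real_analytic_on b {-\<rho><..<\<rho>}"
    unfolding a_def b_def using A(1) B(1) \<rho>(2) by (auto intro: real_analytic_Re_holomorphic)
  have real: "A (of_real z) = of_real (a z)" "B (of_real z) = of_real (b z)" if "\<bar>z\<bar> < \<rho>" for z
    using par[OF that] by (auto simp: a_def b_def)
  have var0: "1 / var \<nu> \<theta>\<^sub>0 \<noteq> 0" using var_pos[OF \<theta>0] by simp
  obtain Q where Q: "polynomial_family Q"
    and gf: "\<And>z x. z \<in> {-\<rho><..<\<rho>} \<Longrightarrow> (\<lambda>n. poly (Q n) x * (z ^ n / fact n)) sums exp (a z * x + b z)"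
    using exponential_polynomial_family[OF A B A' var0 \<rho> real, of thesis] by metis
  have a0: "a 0 = 0" by (simp add: a_def A)
  obtain \<rho>' where \<rho>': "0 < \<rho>'" "\<rho>' \<le> \<rho>"
    and S: "\<And>z g. \<bar>z\<bar> < \<rho>' \<Longrightarrow> (\<lambda>n. (\<integral>x. poly (Q n) x * poly g x \<partial>?\<mu>) / fact n * z ^ n)
        sums (exp (b z) / moment \<nu> 0 \<theta>\<^sub>0 * (\<Sum>i\<le>degree g. coeff g i * moment \<nu> i (\<theta>\<^sub>0 + a z)))"
    using exponential_gf_moments[OF \<theta>0 \<rho>(1) an gf a0] by blast
  have "\<forall>j. \<exists>q. degree q \<le> 2 * j - 1 \<and> (\<forall>\<theta>\<in>Theta \<nu>. moment \<nu> j \<theta> / moment \<nu> 0 \<theta> = poly q (mean \<nu> \<theta>))"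
    using moment_ratio_eq_poly_mean[OF p] by blast
  then obtain q where q: "\<And>j. degree (q j) \<le> 2 * j - 1"
    "\<And>j \<theta>. \<theta> \<in> Theta \<nu> \<Longrightarrow> moment \<nu> j \<theta> / moment \<nu> 0 \<theta> = poly (q j) (mean \<nu> \<theta>)"
    by metis
  have zero: "(\<integral>x. poly (Q n) x * poly g x \<partial>?\<mu>) = 0" if n: "n > 2 * degree g - 1" for n g
  proof -
    define W where "W = pcompose (\<Sum>i\<le>degree g. smult (coeff g i) (q i)) [:mean \<nu> \<theta>\<^sub>0, 1:]"
    have "degree (\<Sum>i\<le>degree g. smult (coeff g i) (q i)) \<le> 2 * degree g - 1"
    proof (rule degree_sum_le)
      fix i assume "i \<in> {..degree g}"
      then show "degree (smult (coeff g i) (q i)) \<le> 2 * degree g - 1"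
        using q(1)[of i] degree_smult_le[of "coeff g i" "q i"] by (simp del: degree_smult_eq)
    qed simp
    then have degW: "degree W \<le> 2 * degree g - 1" by (simp add: W_def degree_pcompose)
    have "(\<lambda>n. (\<integral>x. poly (Q n) x * poly g x \<partial>?\<mu>) / fact n) = coeff W"
    proof (rule real_power_series_unique[OF \<rho>'(1)])
      fix z :: real assume z: "\<bar>z\<bar> < \<rho>'"
      then have "\<bar>z\<bar> < \<rho>" using \<rho>'(2) by simp
      from par[OF this] obtain \<theta> where \<theta>: "\<theta> \<in> Theta \<nu>" "mean \<nu> \<theta> = mean \<nu> \<theta>\<^sub>0 + z"
        "\<theta>\<^sub>0 + a z = \<theta>" "b z = ln (moment \<nu> 0 \<theta>\<^sub>0) - ln (moment \<nu> 0 \<theta>)"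
        by (auto simp: a_def b_def)
      have "exp (b z) / moment \<nu> 0 \<theta>\<^sub>0 = 1 / moment \<nu> 0 \<theta>"
        using moment_0_pos[OF \<theta>0] moment_0_pos[OF \<theta>(1)] by (simp add: \<theta>(4) exp_diff)
      then have "exp (b z) / moment \<nu> 0 \<theta>\<^sub>0 * (\<Sum>i\<le>degree g. coeff g i * moment \<nu> i (\<theta>\<^sub>0 + a z))
          = (\<Sum>i\<le>degree g. coeff g i * (moment \<nu> i \<theta> / moment \<nu> 0 \<theta>))"
        by (simp add: \<theta>(3) sum_divide_distrib)
      also have "\<dots> = poly W z"
        by (simp add: W_def poly_pcompose poly_sum q(2)[OF \<theta>(1)] \<theta>(2))
      finally show "(\<lambda>n. (\<integral>x. poly (Q n) x * poly g x \<partial>?\<mu>) / fact n * z ^ n) sums poly W z"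
        using S[OF z, of g] by simp
      show "(\<lambda>n. coeff W n * z ^ n) sums poly W z"
        using sums_finite[of "{..degree W}" "\<lambda>n. coeff W n * z ^ n"]
        by (simp add: poly_altdef coeff_eq_0)
    qed
    then have "(\<integral>x. poly (Q n) x * poly g x \<partial>?\<mu>) / fact n = coeff W n" by (rule fun_cong)
    also have "\<dots> = 0" using degW n by (intro coeff_eq_0) simp
    finally show ?thesis by simp
  qed
  have "(\<integral>x. poly (Q n) x * poly (Q k) x \<partial>?\<mu>) = 0" if "k \<ge> 1" "2 * k \<le> n" for n k
    using Q that by (intro zero) (simp add: polynomial_family_def)
  moreover have "(\<integral>x. poly (Q n) x \<partial>?\<mu>) = 0" if "n \<ge> 1" for n
    using zero[of 1 n] that by simp
  ultimately have "two_orthogonal ?\<mu> Q"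
    using Q has_all_moments_nef_member[OF \<theta>0] unfolding two_orthogonal_def by blast
  moreover have "exponential_gf Q"
    unfolding exponential_gf_def using \<rho>(1) an gf by blast
  ultimately show ?thesis by blast
qed

end

section \<open>The characterization\<close>

theorem corollary4p1:
  fixes \<nu> \<mu> :: "real measure" and F :: "real measure set" and m\<^sub>o :: real
  assumes "\<nu> \<in> nef_generators" and "F = nef \<nu>"
    and "\<mu> \<in> F" and "(\<integral> x. x \<partial>\<mu>) = m\<^sub>o"
  shows "(\<exists>Q. two_orthogonal \<mu> Q \<and> exponential_gf Q) \<longleftrightarrow> cubic_nef \<nu>"
proof -
  interpret nef_generator \<nu> by unfold_locales (rule assms(1))
  obtain \<theta>\<^sub>0 where \<theta>0: "\<theta>\<^sub>0 \<in> Theta \<nu>" "\<mu> = nef_member \<nu> \<theta>\<^sub>0"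
    using assms(2,3) by (auto simp: nef_def)
  show ?thesis
    unfolding \<theta>0(2)
    using cubic_if_two_orthogonal_exponential[OF \<theta>0(1)] two_orthogonal_exponential_if_cubic[OF _ \<theta>0(1)]
    by blast
qed

end
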